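(* Suppose $f_u(E_k)=\mathbb{C}$ for all $u=1,\ldots,m$. Let $\Omega\subset E_k$ be an arbitrary domain and $\Phi:\Omega\to\mathbb{A}_n^m$ a monogenic function. Then for every $r\in\mathbb{N}$ the Gateaux derivative $\Phi^{(r)}$ of order $r$ exists and is a monogenic function in $\Omega$.
   Context: Fix integers $1\le m\le n$. $\mathbb{A}_n^m$ is an $n$-dimensional commutative associative algebra with unit over $\mathbb{C}$ having a basis $\{I_r\}_{r=1}^n$ with the multiplication rules: (1) for $r,s\in\{1,\ldots,m\}$: $I_rI_s=0$ if $r\ne s$ and $I_rI_r=I_r$; (2) for $r,s\in\{m+1,\ldots,n\}$: $I_rI_s=\sum_{p=\max\{r,s\}+1}^n\Upsilon^s_{r,p}I_p$ with $\Upsilon^s_{r,p}\in\mathbb{C}$; (3) for each $s\in\{m+1,\ldots,n\}$ there is a unique $u_s\in\{1,\ldots,m\}$ such that for all $r\in\{1,\ldots,m\}$: $I_rI_s=I_s$ if $r=u_s$ and $I_rI_s=0$ otherwise. For $u=1,\ldots,m$, $f_u:\mathbb{A}_n^m\to\mathbb{C}$ is the linear functional $f_u(\sum_r\lambda_rI_r)=\lambda_u$. Let $2\le k\le 2n$ and let $e_1=1=\sum_{r=1}^mI_r$, $e_j=\sum_{r=1}^n a_{jr}I_r$ ($j=2,\ldots,k$) be linearly independent over $\mathbb{R}$; $E_k$ is their real linear span. A continuous function $\Phi:\Omega\to\mathbb{A}_n^m$ is monogenic in $\Omega$ if for every $\zeta\in\Omega$ there is $\Phi'(\zeta)\in\mathbb{A}_n^m$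 (the Gateaux derivative) with $\lim_{\varepsilon\to0^+}(\Phi(\zeta+\varepsilon h)-\Phi(\zeta))\varepsilon^{-1}=h\Phi'(\zeta)$ for all $h\in E_k$. Higher Gateaux derivatives are defined by $\Phi^{(r)}:=(\Phi^{(r-1)})'$. *)

theory Defs
  imports "HOL-Analysis.Analysis"
begin

text \<open>Elements of the algebra A_n^m are represented by their coordinate functions
  x :: nat => complex w.r.t. the basis I_1..I_n (coordinates outside 1..n are 0).
  The topology is the product topology (componentwise), which on the finite-dimensional
  carrier coincides with the usual one.\<close>

definition carrierA :: "nat \<Rightarrow> (nat \<Rightarrow> complex) set" where
  "carrierA n = {x. \<forall>i. i \<notin> {1..n} \<longrightarrow> x i = 0}"

definition basisI :: "nat \<Rightarrow> (nat \<Rightarrow> complex)" where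
  "basisI r = (\<lambda>p. if p = r then 1 else 0)"

text \<open>Product of basis elements I_r I_s. Ups s r p is the constant Upsilon^s_{r,p};
  uu s is the index u_s.\<close>
definition bprod :: "nat \<Rightarrow> nat \<Rightarrow> (nat \<Rightarrow> nat \<Rightarrow> nat \<Rightarrow> complex) \<Rightarrow> (nat \<Rightarrow> nat)
    \<Rightarrow> nat \<Rightarrow> nat \<Rightarrow> (nat \<Rightarrow> complex)" where
  "bprod n m Ups uu r s =
    (if r \<le> m \<and> s \<le> m then (if r = s then basisI r else (\<lambda>_. 0))
     else if m < r \<and> m < s then (\<lambda>p. if max r s < p \<and> p \<le> n then Ups s r p else 0)
     else if r \<le> m then (if uu s = r then basisI s else (\<lambda>_. 0))
     else (if uu r = s then basisI r else (\<lambda>_. 0)))"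

definition amult :: "nat \<Rightarrow> nat \<Rightarrow> (nat \<Rightarrow> nat \<Rightarrow> nat \<Rightarrow> complex) \<Rightarrow> (nat \<Rightarrow> nat)
    \<Rightarrow> (nat \<Rightarrow> complex) \<Rightarrow> (nat \<Rightarrow> complex) \<Rightarrow> (nat \<Rightarrow> complex)" where
  "amult n m Ups uu a b =
    (\<lambda>p. \<Sum>r=1..n. \<Sum>s=1..n. a r * b s * bprod n m Ups uu r s p)"

definition aunit :: "nat \<Rightarrow> (nat \<Rightarrow> complex)" where
  "aunit m = (\<lambda>p. if 1 \<le> p \<and> p \<le> m then 1 else 0)"

definition Espan :: "nat \<Rightarrow> (nat \<Rightarrow> (nat \<Rightarrow> complex)) \<Rightarrow> (nat \<Rightarrow> complex) set" where
  "Espan k e = {x. \<exists>c :: nat \<Rightarrow> real. x = (\<lambda>p. \<Sum>j=1..k. complex_of_real (c j) * e j p)}"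

definition vadd_rscale :: "(nat \<Rightarrow> complex) \<Rightarrow> real \<Rightarrow> (nat \<Rightarrow> complex) \<Rightarrow> (nat \<Rightarrow> complex)" where
  "vadd_rscale z t h = (\<lambda>p. z p + complex_of_real t * h p)"

definition gateaux_deriv_on where
  "gateaux_deriv_on n m Ups uu E \<Omega> \<Phi> D \<longleftrightarrow>
     (\<forall>\<zeta>\<in>\<Omega>. D \<zeta> \<in> carrierA n \<and>
        (\<forall>h\<in>E. ((\<lambda>\<epsilon>::real. (\<lambda>p. (\<Phi> (vadd_rscale \<zeta> \<epsilon> h) p - \<Phi> \<zeta> p) / complex_of_real \<epsilon>))
                 \<longlongrightarrow> amult n m Ups uu h (D \<zeta>)) (at_right 0)))"

definition monogenic where
  "monogenic n m Ups uu E \<Omega> \<Phi> \<longleftrightarrow>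
     \<Phi> ` \<Omega> \<subseteq> carrierA n \<and> continuous_on \<Omega> \<Phi> \<and>
     (\<exists>D. gateaux_deriv_on n m Ups uu E \<Omega> \<Phi> D)"

end

theory Submission
  imports Defs "HOL-Complex_Analysis.Complex_Analysis"
begin

text \<open>
  For a direction \<open>h\<close>, the \<open>r\<close>-th component of \<open>h \<Phi>'\<close> is \<open>f\<^sub>u(h) \<Phi>'\<^sub>r\<close> (\<open>u = u\<^sub>r\<close>) as soon as the
  components of \<open>\<Phi>\<close> below \<open>r\<close> vanish. Hence \<open>\<Phi>\<^sub>r\<close> is constant along the fibres of \<open>f\<^sub>u\<close> and locally equals
  \<open>F(f\<^sub>u(\<zeta>))\<close>, where \<open>F\<close> is continuous with directional derivatives satisfying the Cauchy-Riemann
  equations; \<open>F\<close> is holomorphic by the Looman-Menchoff theorem. The finite Taylor sum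
  \<open>\<Sum>\<^sub>k F\<^sup>(\<^sup>k\<^sup>)(f\<^sub>u(\<zeta>)) I\<^sub>r (\<zeta> - f\<^sub>u(\<zeta>))\<^sup>k / k!\<close> is infinitely often Gateaux differentiable, is monogenic and has
  \<open>r\<close>-th component \<open>F(f\<^sub>u(\<zeta>))\<close>; subtracting it makes the components of \<open>\<Phi>\<close> up to \<open>r\<close> vanish. After \<open>n\<close>
  steps \<open>\<Phi>\<close> is locally a sum of such Taylor sums, so \<open>\<Phi>'\<close> is monogenic.

  For Looman-Menchoff, Baire's theorem gives a disc in which the difference quotients at the points of
  the singular set \<open>K\<close> are uniformly bounded. Shrinking a rectangle \<open>R\<close> until its sides touch \<open>K\<close> shows that
  the integral of \<open>f\<close> over \<open>\<partial>R\<close> is \<open>O(|R|)\<close>, with an arbitrarily small constant on finitely many disjoint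
  compact subsets of \<open>K\<close> which exhaust it up to small measure. Summing over a fine grid, the integral vanishes.
\<close>

section \<open>The Looman-Menchoff theorem\<close>

definition rect :: "real \<Rightarrow> real \<Rightarrow> real \<Rightarrow> real \<Rightarrow> complex set" where
  "rect a b c d = cbox (Complex a c) (Complex b d)"

text \<open>Four separate line integrals rather than one joined path: when a rectangle is cut, the
  two integrals along the cut then cancel by plain arithmetic. Degenerate rectangles are
  allowed.\<close>

definition rect_integral :: "(complex \<Rightarrow> complex) \<Rightarrow> real \<Rightarrow> real \<Rightarrow> real \<Rightarrow> real \<Rightarrow> complex" where
  "rect_integral f a b c d =
     contour_integral (linepath (Complex a c) (Complex b c)) f +
     contour_integral (linepath (Complex b c) (Complex b d)) f +
     contour_integral (linepath (Complex b d) (Complex a d)) f +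
     contour_integral (linepath (Complex a d) (Complex a c)) f"

lemma mem_rect: "z \<in> rect a b c d \<longleftrightarrow> a \<le> Re z \<and> Re z \<le> b \<and> c \<le> Im z \<and> Im z \<le> d"
  by (auto simp: rect_def in_cbox_complex_iff)

lemma convex_rect [simp]: "convex (rect a b c d)"
  by (simp add: rect_def)

lemma compact_rect [simp]: "compact (rect a b c d)"
  by (simp add: rect_def)

lemma closed_segment_subset_rect:
  "\<lbrakk>z \<in> rect a b c d; w \<in> rect a b c d\<rbrakk> \<Longrightarrow> closed_segment z w \<subseteq> rect a b c d"
  by (simp add: closed_segment_subset)

lemma measure_rect:
  assumes "a \<le> b" "c \<le> d"
  shows "measure lebesgue (rect a b c d) = (b - a) * (d - c)"
  using assms by (simp add: rect_def content_cbox_if Basis_complex_def in_cbox_complex_iff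
      flip: box_ne_empty(1) add: box_eq_empty inner_complex_def mult.commute)

text \<open>The two parts traverse the cut at abscissa \<open>x\<close> in opposite
  directions.\<close>

lemma rect_integral_split_Re:
  assumes "a \<le> x" "x \<le> b" "c \<le> d" and f: "continuous_on (rect a b c d) f"
  shows "rect_integral f a b c d = rect_integral f a x c d + rect_integral f x b c d"
proof -
  have cont: "continuous_on (closed_segment z w) f" if "z \<in> rect a b c d" "w \<in> rect a b c d" for z w
    using closed_segment_subset_rect[OF that] f continuous_on_subset by blast
  have 1: "contour_integral (linepath (Complex a c) (Complex b c)) f
    = contour_integral (linepath (Complex a c) (Complex x c)) f
      + contour_integral (linepath (Complex x c) (Complex b c)) f"
    using assms by (intro contour_integral_split_linepath cont)
      (auto simp: mem_rect closed_segment_same_Im closed_segment_eq_real_ivl)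
  have 2: "contour_integral (linepath (Complex b d) (Complex a d)) f
    = contour_integral (linepath (Complex b d) (Complex x d)) f
      + contour_integral (linepath (Complex x d) (Complex a d)) f"
    using assms by (intro contour_integral_split_linepath cont)
      (auto simp: mem_rect closed_segment_same_Im closed_segment_eq_real_ivl)
  have 3: "contour_integral (linepath (Complex x d) (Complex x c)) f
    = - contour_integral (linepath (Complex x c) (Complex x d)) f"
    using assms by (intro contour_integral_reverse_linepath cont) (auto simp: mem_rect)
  show ?thesis unfolding rect_integral_def 1 2 3 by simp
qed

lemma rect_integral_split_Im:
  assumes "a \<le> b" "c \<le> y" "y \<le> d" and f: "continuous_on (rect a b c d) f"
  shows "rect_integral f a b c d = rect_integral f a b c y + rect_integral f a b y d"
proof -
  have cont: "continuous_on (closed_segment z w) f" if "z \<in> rect a b c d" "w \<in> rect a b c d" for z w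
    using closed_segment_subset_rect[OF that] f continuous_on_subset by blast
  have 1: "contour_integral (linepath (Complex b c) (Complex b d)) f
    = contour_integral (linepath (Complex b c) (Complex b y)) f
      + contour_integral (linepath (Complex b y) (Complex b d)) f"
    using assms by (intro contour_integral_split_linepath cont)
      (auto simp: mem_rect closed_segment_same_Re closed_segment_eq_real_ivl)
  have 2: "contour_integral (linepath (Complex a d) (Complex a c)) f
    = contour_integral (linepath (Complex a d) (Complex a y)) f
      + contour_integral (linepath (Complex a y) (Complex a c)) f"
    using assms by (intro contour_integral_split_linepath cont)
      (auto simp: mem_rect closed_segment_same_Re closed_segment_eq_real_ivl)
  have 3: "contour_integral (linepath (Complex b y) (Complex a y)) f
    = - contour_integral (linepath (Complex a y) (Complex b y)) f"
    using assms by (intro contour_integral_reverse_linepath cont) (auto simp: mem_rect)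
  show ?thesis unfolding rect_integral_def 1 2 3 by simp
qed

text \<open>Cauchy's theorem on a convex set asks for differentiability in the interior and
  continuity up to the boundary. A degenerate rectangle has empty interior, so its integral vanishes
  for every continuous \<open>f\<close>.\<close>

lemma rect_integral_eq_0:
  assumes "a \<le> b" "c \<le> d" and f: "continuous_on (rect a b c d) f"
    and holo: "f holomorphic_on box (Complex a c) (Complex b d)"
  shows "rect_integral f a b c d = 0"
proof -
  define \<gamma> where "\<gamma> = rectpath (Complex a c) (Complex b d)"
  have cont: "f contour_integrable_on linepath z w" if "z \<in> rect a b c d" "w \<in> rect a b c d" for z w
    using closed_segment_subset_rect[OF that] f continuous_on_subset
      contour_integrable_continuous_linepath by blast
  have "(f has_contour_integral 0) \<gamma>"
  proof (rule Cauchy_theorem_convex[where S = "rect a b c d" and K = "{}"])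
    show "f field_differentiable at x" if "x \<in> interior (rect a b c d) - {}" for x
      using that holo by (auto simp: rect_def interior_cbox holomorphic_on_open
          field_differentiable_def open_box)
    show "path_image \<gamma> \<subseteq> rect a b c d"
      using assms path_image_rectpath_subset_cbox by (auto simp: \<gamma>_def rect_def)
  qed (use f in \<open>auto simp: \<gamma>_def\<close>)
  moreover have "contour_integral \<gamma> f = rect_integral f a b c d"
    unfolding \<gamma>_def rectpath_def rect_integral_def using assms
    by (simp add: Let_def cont mem_rect contour_integrable_joinI valid_path_join f)
  ultimately show ?thesis
    by (simp add: contour_integral_unique)
qed

lemma rect_integral_diff:
  assumes "a \<le> b" "c \<le> d"
    and f: "continuous_on (rect a b c d) f" and g: "continuous_on (rect a b c d) g"
  shows "rect_integral (\<lambda>z. f z - g z) a b c d = rect_integral f a b c d - rect_integral g a b c d"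
proof -
  have cont: "h contour_integrable_on linepath z w"
    if "z \<in> rect a b c d" "w \<in> rect a b c d" "continuous_on (rect a b c d) h" for z w h
    using closed_segment_subset_rect[OF that(1,2)] that(3) continuous_on_subset
      contour_integrable_continuous_linepath by blast
  show ?thesis
    using assms unfolding rect_integral_def
    by (simp add: contour_integral_diff cont mem_rect)
qed

text \<open>The factor after \<open>M\<close> is the perimeter.\<close>

lemma norm_rect_integral_le:
  assumes "a \<le> b" "c \<le> d" "0 \<le> M" and f: "continuous_on (rect a b c d) f"
    and M: "\<And>z. \<lbrakk>z \<in> rect a b c d; Re z = a \<or> Re z = b \<or> Im z = c \<or> Im z = d\<rbrakk> \<Longrightarrow> norm (f z) \<le> M"
  shows "norm (rect_integral f a b c d) \<le> 2 * M * ((b - a) + (d - c))"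
proof -
  have *: "norm (contour_integral (linepath z w) f) \<le> M * norm (w - z)"
    if "z \<in> rect a b c d" "w \<in> rect a b c d"
      and "Re z = Re w \<and> (Re z = a \<or> Re z = b) \<or> Im z = Im w \<and> (Im z = c \<or> Im z = d)" for z w
  proof (rule contour_integral_bound_linepath)
    have sub: "closed_segment z w \<subseteq> rect a b c d"
      using closed_segment_subset_rect that by blast
    then show "f contour_integrable_on linepath z w"
      using f continuous_on_subset contour_integrable_continuous_linepath by blast
    fix v assume v: "v \<in> closed_segment z w"
    with that(3) have "Re v = a \<or> Re v = b \<or> Im v = c \<or> Im v = d"
      by (auto simp: closed_segment_same_Re closed_segment_same_Im)
    with v sub show "norm (f v) \<le> M" using M by blast
  qed (use assms in auto)
  have "norm (contour_integral (linepath (Complex a c) (Complex b c)) f) \<le> M * (b - a)"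
    "norm (contour_integral (linepath (Complex b c) (Complex b d)) f) \<le> M * (d - c)"
    "norm (contour_integral (linepath (Complex b d) (Complex a d)) f) \<le> M * (b - a)"
    "norm (contour_integral (linepath (Complex a d) (Complex a c)) f) \<le> M * (d - c)"
    using *[of "Complex a c" "Complex b c"] *[of "Complex b c" "Complex b d"]
      *[of "Complex b d" "Complex a d"] *[of "Complex a d" "Complex a c"] assms(1,2)
    by (simp_all add: mem_rect cmod_def)
  then show ?thesis unfolding rect_integral_def
    by (intro order_trans[OF norm_triangle_ineq] order_trans[OF add_mono[OF norm_triangle_ineq order_refl]]
        order_trans[OF add_mono[OF add_mono[OF norm_triangle_ineq order_refl] order_refl]])
       (simp add: algebra_simps)
qed

text \<open>Subtracting an affine function does not change the integral. What remains is small on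
  the whole boundary, because each side lies on a horizontal or vertical line through a point of
  \<open>S\<close>, from which \<open>approx\<close> controls that side.\<close>

lemma rect_integral_touch_bound:
  assumes "a \<le> b" "c \<le> d" "0 \<le> \<kappa>" and f: "continuous_on (rect a b c d) f"
    and approx: "\<And>z w. \<lbrakk>z \<in> S; w \<in> rect a b c d; Re w = Re z \<or> Im w = Im z\<rbrakk>
        \<Longrightarrow> norm (f w - f z - s * (w - z)) \<le> \<kappa> * norm (w - z)"
    and S: "S \<subseteq> rect a b c d" "a \<in> Re ` S" "b \<in> Re ` S" "c \<in> Im ` S" "d \<in> Im ` S"
  shows "norm (rect_integral f a b c d) \<le> 4 * \<kappa> * ((b - a) + (d - c))\<^sup>2"
proof -
  \<comment> \<open>The affine function has slope \<open>s\<close> and agrees with \<open>f\<close>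
    at the lower left corner, so that \<open>g\<close> vanishes there.\<close>
  define P where "P = Complex a c"
  define l where "l = (\<lambda>z. f P + s * (z - P))"
  define g where "g = (\<lambda>z. f z - l z)"
  have l: "continuous_on A l" "l holomorphic_on A" for A
    unfolding l_def by (intro continuous_intros holomorphic_intros)+
  have g: "continuous_on (rect a b c d) g"
    unfolding g_def by (intro continuous_intros f l)
  have gd: "norm (g w - g z) \<le> \<kappa> * norm (w - z)"
    if "z \<in> S" "w \<in> rect a b c d" "Re w = Re z \<or> Im w = Im z" for z w
    using approx[OF that] by (simp add: g_def l_def algebra_simps)
  \<comment> \<open>Both points are compared with a point of \<open>S\<close> on the same vertical
    line; each comparison costs at most \<open>\<kappa>\<close> times the height.\<close>
  have same_Re: "norm (g w - g v) \<le> 2 * \<kappa> * (d - c)"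
    if "w \<in> rect a b c d" "v \<in> rect a b c d" "Re w = Re v" and v: "Re v \<in> Re ` S" for w v
  proof -
    obtain z where z: "z \<in> S" "Re z = Re v" using v by (metis imageE)
    have *: "norm (g u - g z) \<le> \<kappa> * (d - c)" if "u \<in> rect a b c d" "Re u = Re z" for u
    proof -
      have "norm (u - z) \<le> d - c"
        using that z S(1) by (auto simp: cmod_eq_Im mem_rect subset_iff abs_le_iff)
      then show ?thesis using gd[OF z(1) that(1)] that assms(3)
        by (meson mult_left_mono order_trans)
    qed
    have "norm (g w - g v) \<le> norm (g w - g z) + norm (g v - g z)"
      by (metis norm_triangle_ineq4 diff_diff_eq2 diff_add_cancel add_diff_cancel_right)
    then show ?thesis using *[of w] *[of v] that z by auto
  qed
  have same_Im: "norm (g w - g v) \<le> 2 * \<kappa> * (b - a)"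
    if "w \<in> rect a b c d" "v \<in> rect a b c d" "Im w = Im v" and v: "Im v \<in> Im ` S" for w v
  proof -
    obtain z where z: "z \<in> S" "Im z = Im v" using v by (metis imageE)
    have *: "norm (g u - g z) \<le> \<kappa> * (b - a)" if "u \<in> rect a b c d" "Im u = Im z" for u
    proof -
      have "norm (u - z) \<le> b - a"
        using that z S(1) by (auto simp: cmod_eq_Re mem_rect subset_iff abs_le_iff)
      then show ?thesis using gd[OF z(1) that(1)] that assms(3)
        by (meson mult_left_mono order_trans)
    qed
    have "norm (g w - g v) \<le> norm (g w - g z) + norm (g v - g z)"
      by (metis norm_triangle_ineq4 diff_diff_eq2 diff_add_cancel add_diff_cancel_right)
    then show ?thesis using *[of w] *[of v] that z by auto
  qed
  have gP: "g P = 0" by (simp add: g_def l_def)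
  have nonneg: "0 \<le> 2 * \<kappa> * (b - a)" "0 \<le> 2 * \<kappa> * (d - c)" using assms by auto
  \<comment> \<open>A boundary point reaches the corner \<open>P\<close> along at most one vertical
    and one horizontal piece of the boundary, through the corner \<open>Complex b c\<close> or
    \<open>Complex a d\<close> if necessary.\<close>
  have bound: "norm (g w) \<le> 2 * \<kappa> * ((b - a) + (d - c))"
    if w: "w \<in> rect a b c d" "Re w = a \<or> Re w = b \<or> Im w = c \<or> Im w = d" for w
  proof -
    have cor: "P \<in> rect a b c d" "Complex b c \<in> rect a b c d" "Complex a d \<in> rect a b c d"
      using assms by (auto simp: P_def mem_rect)
    have tri: "norm (g w) \<le> norm (g w - g v) + norm (g v - g P)" for v
      using norm_triangle_ineq[of "g w - g v" "g v - g P"] gP by simp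
    show ?thesis using w(2)
    proof (elim disjE)
      assume "Re w = a"
      then show ?thesis using tri[of P] same_Re[of w P] w cor S nonneg
        by (simp add: P_def algebra_simps)
    next
      assume "Im w = c"
      then show ?thesis using tri[of P] same_Im[of w P] w cor S nonneg
        by (simp add: P_def algebra_simps)
    next
      assume "Re w = b"
      then show ?thesis using tri[of "Complex b c"] same_Re[of w "Complex b c"]
          same_Im[of "Complex b c" P] w cor S by (simp add: P_def algebra_simps)
    next
      assume "Im w = d"
      then show ?thesis using tri[of "Complex a d"] same_Im[of w "Complex a d"]
          same_Re[of "Complex a d" P] w cor S by (simp add: P_def algebra_simps)
    qed
  qed
  have "rect_integral g a b c d = rect_integral f a b c d"
    using rect_integral_diff[OF assms(1,2) f l(1)] rect_integral_eq_0[OF assms(1,2) l]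
    by (simp add: g_def)
  moreover have "norm (rect_integral g a b c d)
      \<le> 2 * (2 * \<kappa> * ((b - a) + (d - c))) * ((b - a) + (d - c))"
    using assms by (intro norm_rect_integral_le g bound) auto
  ultimately show ?thesis by (simp add: power2_eq_square algebra_simps)
qed

section \<open>Shrinking and bisecting rectangles\<close>

text \<open>The new rectangle is the bounding box of \<open>S\<close>; compactness makes each of its
  sides touch \<open>S\<close>. The other four terms belong to the strips cut off on the left, on
  the right, below and above.\<close>

lemma rect_shrink:
  assumes S: "compact S" "S \<noteq> {}" "S \<subseteq> rect a b c d" and f: "continuous_on (rect a b c d) f"
  obtains a' b' c' d' where "a \<le> a'" "a' \<le> b'" "b' \<le> b" "c \<le> c'" "c' \<le> d'" "d' \<le> d"
    "S \<subseteq> rect a' b' c' d'"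
    "a' \<in> Re ` S" "b' \<in> Re ` S" "c' \<in> Im ` S" "d' \<in> Im ` S"
    "rect_integral f a b c d = rect_integral f a' b' c' d' + rect_integral f a a' c d
       + rect_integral f b' b c d + rect_integral f a' b' c c' + rect_integral f a' b' d' d"
proof -
  have cRe: "compact (Re ` S)" and cIm: "compact (Im ` S)"
    by (intro compact_continuous_image continuous_intros S)+
  obtain a' where a': "a' \<in> Re ` S" "\<And>z. z \<in> S \<Longrightarrow> a' \<le> Re z"
    using compact_attains_inf[OF cRe] S(2) by auto
  obtain b' where b': "b' \<in> Re ` S" "\<And>z. z \<in> S \<Longrightarrow> Re z \<le> b'"
    using compact_attains_sup[OF cRe] S(2) by auto
  obtain c' where c': "c' \<in> Im ` S" "\<And>z. z \<in> S \<Longrightarrow> c' \<le> Im z"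
    using compact_attains_inf[OF cIm] S(2) by auto
  obtain d' where d': "d' \<in> Im ` S" "\<And>z. z \<in> S \<Longrightarrow> Im z \<le> d'"
    using compact_attains_sup[OF cIm] S(2) by auto
  have ineq: "a \<le> a'" "a' \<le> b'" "b' \<le> b" "c \<le> c'" "c' \<le> d'" "d' \<le> d"
    using a' b' c' d' S(3) by (fastforce simp: mem_rect)+
  have sub: "continuous_on (rect p q r s) f" if "a \<le> p" "q \<le> b" "c \<le> r" "s \<le> d" for p q r s
    by (rule continuous_on_subset[OF f]) (use that in \<open>auto simp: mem_rect\<close>)
  have "rect_integral f a b c d = rect_integral f a a' c d + rect_integral f a' b c d"
    using ineq by (intro rect_integral_split_Re f) auto
  also have "rect_integral f a' b c d = rect_integral f a' b' c d + rect_integral f b' b c d"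
    using ineq by (intro rect_integral_split_Re sub) auto
  also have "rect_integral f a' b' c d = rect_integral f a' b' c c' + rect_integral f a' b' c' d"
    using ineq by (intro rect_integral_split_Im sub) auto
  also have "rect_integral f a' b' c' d = rect_integral f a' b' c' d' + rect_integral f a' b' d' d"
    using ineq by (intro rect_integral_split_Im sub) auto
  finally show ?thesis
    using a' b' c' d' ineq by (intro that[of a' b' c' d']) (auto simp: mem_rect)
qed

text \<open>Dyadic subdivision: a property that survives gluing along a cut has to be checked only
  on cells of the \<open>2 ^ n\<close> by \<open>2 ^ n\<close> grid, all similar to the original
  rectangle.\<close>

lemma rect_bisect:
  fixes P :: "real \<Rightarrow> real \<Rightarrow> real \<Rightarrow> real \<Rightarrow> bool"
  assumes Re_join: "\<And>a x b c d. \<lbrakk>a0 \<le> a; a \<le> x; x \<le> b; b \<le> b0; c0 \<le> c; c \<le> d; d \<le> d0;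
      P a x c d; P x b c d\<rbrakk> \<Longrightarrow> P a b c d"
    and Im_join: "\<And>a b c y d. \<lbrakk>a0 \<le> a; a \<le> b; b \<le> b0; c0 \<le> c; c \<le> y; y \<le> d; d \<le> d0;
      P a b c y; P a b y d\<rbrakk> \<Longrightarrow> P a b c d"
    and small: "\<And>a b c d. \<lbrakk>a0 \<le> a; a \<le> b; b \<le> b0; c0 \<le> c; c \<le> d; d \<le> d0;
      b - a = (b0 - a0) / 2 ^ n; d - c = (d0 - c0) / 2 ^ n\<rbrakk> \<Longrightarrow> P a b c d"
    and "a0 \<le> b0" "c0 \<le> d0"
  shows "P a0 b0 c0 d0"
proof -
  \<comment> \<open>\<open>k\<close> counts the bisections still separating the rectangle from the
    cells of the grid; \<open>k = n\<close> is the original rectangle.\<close>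
  have "P a b c d"
    if "a0 \<le> a" "a \<le> b" "b \<le> b0" "c0 \<le> c" "c \<le> d" "d \<le> d0"
      "b - a = (b0 - a0) / 2 ^ (n - k)" "d - c = (d0 - c0) / 2 ^ (n - k)" "k \<le> n" for a b c d k
    using that
  proof (induction k arbitrary: a b c d)
    case 0
    then show ?case using small by simp
  next
    case (Suc k)
    have eq: "(2::real) ^ (n - k) = 2 * 2 ^ (n - Suc k)"
      using \<open>Suc k \<le> n\<close> by (simp add: Suc_diff_Suc flip: power_Suc)
    define x y where "x = (a + b) / 2" and "y = (c + d) / 2"
    have xy: "x - a = (b0 - a0) / 2 ^ (n - k)" "b - x = (b0 - a0) / 2 ^ (n - k)"
      "y - c = (d0 - c0) / 2 ^ (n - k)" "d - y = (d0 - c0) / 2 ^ (n - k)"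
      "a \<le> x" "x \<le> b" "c \<le> y" "y \<le> d"
      using Suc.prems by (auto simp: x_def y_def eq field_simps)
    have "P a x c y" "P x b c y" "P a x y d" "P x b y d"
      by (intro Suc.IH; use Suc.prems xy in linarith)+
    then have "P a b c y" "P a b y d"
      using Re_join[of a x b c y] Re_join[of a x b y d] Suc.prems xy by auto
    then show ?case using Im_join[of a b c y d] Suc.prems xy by auto
  qed
  from this[of a0 b0 c0 d0 n] show ?thesis using assms(4,5) by simp
qed

text \<open>The two parts overlap in a segment, which is negligible.\<close>

lemma measure_rect_Int_split_Re:
  assumes "a \<le> x" "x \<le> b" "W \<in> lmeasurable"
  shows "measure lebesgue (rect a b c d \<inter> W)
    = measure lebesgue (rect a x c d \<inter> W) + measure lebesgue (rect x b c d \<inter> W)"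
proof -
  have meas: "rect p q r s \<inter> W \<in> lmeasurable" for p q r s
    using assms(3) by (simp add: rect_def fmeasurable.Int)
  have "negligible (rect x x c d)"
    by (simp add: rect_def negligible_interval box_eq_empty Basis_complex_def)
  then have "negligible ((rect a x c d \<inter> W) \<inter> (rect x b c d \<inter> W))"
    by (rule negligible_subset) (auto simp: mem_rect)
  then have "measure lebesgue ((rect a x c d \<inter> W) \<inter> (rect x b c d \<inter> W)) = 0"
    by (rule negligible_imp_measure0)
  moreover have "(rect a x c d \<inter> W) \<union> (rect x b c d \<inter> W) = rect a b c d \<inter> W"
    using assms by (auto simp: mem_rect)
  ultimately show ?thesis
    using measure_Un3[OF meas meas, of a x c d x b c d] by simp
qed

lemma measure_rect_Int_split_Im:
  assumes "c \<le> y" "y \<le> d" "W \<in> lmeasurable"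
  shows "measure lebesgue (rect a b c d \<inter> W)
    = measure lebesgue (rect a b c y \<inter> W) + measure lebesgue (rect a b y d \<inter> W)"
proof -
  have meas: "rect p q r s \<inter> W \<in> lmeasurable" for p q r s
    using assms(3) by (simp add: rect_def fmeasurable.Int)
  have "negligible (rect a b y y)"
    by (simp add: rect_def negligible_interval box_eq_empty Basis_complex_def)
  then have "negligible ((rect a b c y \<inter> W) \<inter> (rect a b y d \<inter> W))"
    by (rule negligible_subset) (auto simp: mem_rect)
  then have "measure lebesgue ((rect a b c y \<inter> W) \<inter> (rect a b y d \<inter> W)) = 0"
    by (rule negligible_imp_measure0)
  moreover have "(rect a b c y \<inter> W) \<union> (rect a b y d \<inter> W) = rect a b c d \<inter> W"
    using assms by (auto simp: mem_rect)
  ultimately show ?thesis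
    using measure_Un3[OF meas meas, of a b c y a b y d] by simp
qed

text \<open>Shrink the rectangle to the bounding box of the part of \<open>S\<close> inside it. The
  box is handled by \<open>rect_integral_touch_bound\<close>. The strips have interiors free of
  \<open>S\<close>, so \<open>off_S\<close> bounds them by \<open>C\<close> times their area, and
  their total area is at most that of the complement of \<open>S\<close>.\<close>

lemma norm_rect_integral_approx:
  assumes R: "a \<le> b" "c \<le> d" and f: "continuous_on (rect a b c d) f" and "0 \<le> \<kappa>" "0 \<le> C"
    and S: "compact S" "S \<inter> rect a b c d \<noteq> {}"
    and off_S: "\<And>p q r s. \<lbrakk>p \<le> q; r \<le> s; rect p q r s \<subseteq> rect a b c d;
        box (Complex p r) (Complex q s) \<inter> S = {}\<rbrakk>
        \<Longrightarrow> norm (rect_integral f p q r s) \<le> C * ((q - p) * (s - r))"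
    and approx: "\<And>z w. \<lbrakk>z \<in> S; z \<in> rect a b c d; w \<in> rect a b c d; Re w = Re z \<or> Im w = Im z\<rbrakk>
        \<Longrightarrow> norm (f w - f z - s * (w - z)) \<le> \<kappa> * norm (w - z)"
  shows "norm (rect_integral f a b c d)
    \<le> 4 * \<kappa> * ((b - a) + (d - c))\<^sup>2 + C * measure lebesgue (rect a b c d - S)"
proof -
  let ?S = "S \<inter> rect a b c d"
  obtain a' b' c' d' where *: "a \<le> a'" "a' \<le> b'" "b' \<le> b" "c \<le> c'" "c' \<le> d'" "d' \<le> d"
    and S': "?S \<subseteq> rect a' b' c' d'" "a' \<in> Re ` ?S" "b' \<in> Re ` ?S" "c' \<in> Im ` ?S" "d' \<in> Im ` ?S"
    and eq: "rect_integral f a b c d = rect_integral f a' b' c' d' + rect_integral f a a' c d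
       + rect_integral f b' b c d + rect_integral f a' b' c c' + rect_integral f a' b' d' d"
    by (rule rect_shrink[OF _ S(2) _ f]) (use S(1) in \<open>auto intro: compact_Int\<close>)
  have sub: "rect a' b' c' d' \<subseteq> rect a b c d" using * by (auto simp: mem_rect)
  have "norm (rect_integral f a' b' c' d') \<le> 4 * \<kappa> * ((b' - a') + (d' - c'))\<^sup>2"
    by (rule rect_integral_touch_bound[OF _ _ assms(4) _ _ S'])
       (use * sub approx f continuous_on_subset in auto)
  also have "\<dots> \<le> 4 * \<kappa> * ((b - a) + (d - c))\<^sup>2"
    using * assms(4) by (intro mult_left_mono power_mono) auto
  finally have inner: "norm (rect_integral f a' b' c' d') \<le> 4 * \<kappa> * ((b - a) + (d - c))\<^sup>2" .
  \<comment> \<open>A rectangle whose interior avoids the bounding box also has no point of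
    \<open>S\<close> in its interior, so \<open>off_S\<close> applies to each strip.\<close>
  have C': "norm (rect_integral f p q r s) \<le> C * ((q - p) * (s - r))"
    if "p \<le> q" "r \<le> s" "rect p q r s \<subseteq> rect a b c d"
      "\<And>z. z \<in> box (Complex p r) (Complex q s) \<Longrightarrow> z \<notin> rect a' b' c' d'" for p q r s
  proof (rule off_S)
    show "box (Complex p r) (Complex q s) \<inter> S = {}"
      using that(3,4) S'(1) box_subset_cbox[of "Complex p r" "Complex q s"]
      unfolding rect_def by blast
  qed (use that in auto)
  have "rect a a' c d \<subseteq> rect a b c d" "rect b' b c d \<subseteq> rect a b c d"
    "rect a' b' c c' \<subseteq> rect a b c d" "rect a' b' d' d \<subseteq> rect a b c d"
    using * by (auto simp: mem_rect)
  then have "norm (rect_integral f a a' c d) \<le> C * ((a' - a) * (d - c))"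
    "norm (rect_integral f b' b c d) \<le> C * ((b - b') * (d - c))"
    "norm (rect_integral f a' b' c c') \<le> C * ((b' - a') * (c' - c))"
    "norm (rect_integral f a' b' d' d) \<le> C * ((b' - a') * (d - d'))"
    using * R by (auto intro!: C' simp: mem_rect in_box_complex_iff)
  then have outer: "norm (rect_integral f a a' c d + rect_integral f b' b c d
      + rect_integral f a' b' c c' + rect_integral f a' b' d' d)
    \<le> C * ((b - a) * (d - c) - (b' - a') * (d' - c'))"
    by (intro order_trans[OF norm_triangle_ineq]
        order_trans[OF add_mono[OF norm_triangle_ineq order_refl]]
        order_trans[OF add_mono[OF add_mono[OF norm_triangle_ineq order_refl] order_refl]])
       (simp add: algebra_simps)
  \<comment> \<open>The left side is the total area of the four strips.\<close>
  have "(b - a) * (d - c) - (b' - a') * (d' - c')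
    = measure lebesgue (rect a b c d) - measure lebesgue (rect a' b' c' d')"
    using R * by (simp add: measure_rect)
  also have "\<dots> = measure lebesgue (rect a b c d - rect a' b' c' d')"
    by (rule measure_Diff[symmetric])
       (use sub in \<open>auto simp: rect_def emeasure_lborel_cbox_eq\<close>)
  also have "\<dots> \<le> measure lebesgue (rect a b c d - S)"
    using S' S(1) by (intro measure_mono_fmeasurable)
      (auto simp: rect_def compact_imp_closed fmeasurable.Diff lmeasurable_compact)
  finally have "C * ((b - a) * (d - c) - (b' - a') * (d' - c'))
    \<le> C * measure lebesgue (rect a b c d - S)"
    using \<open>0 \<le> C\<close> by (rule mult_left_mono)
  moreover have "norm (rect_integral f a b c d) \<le> norm (rect_integral f a' b' c' d')
    + norm (rect_integral f a a' c d + rect_integral f b' b c d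
      + rect_integral f a' b' c c' + rect_integral f a' b' d' d)"
    unfolding eq using norm_triangle_ineq[of "rect_integral f a' b' c' d'"]
    by (simp only: add.assoc)
  ultimately show ?thesis using inner outer by simp
qed

section \<open>Functions with bounded axis-parallel difference quotients at the singular set\<close>

text \<open>The situation that Baire's theorem produces: \<open>K\<close> contains all singularities
  of \<open>f\<close> in \<open>B\<close>, and \<open>N\<close> bounds the horizontal and vertical
  difference quotients based at points of \<open>K\<close>.\<close>

locale holomorphic_off =
  fixes f :: "complex \<Rightarrow> complex" and B K :: "complex set" and N :: real
  assumes cont: "continuous_on B f" and openB: "open B" and closedK: "closed K"
    and holo: "f holomorphic_on (B - K)" and N: "0 \<le> N"
    and lip: "\<And>z w. \<lbrakk>z \<in> K; z \<in> B; w \<in> B; Re w = Re z \<or> Im w = Im z\<rbrakk>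
      \<Longrightarrow> norm (f w - f z) \<le> N * norm (w - z)"
begin

lemma rect_integral_eq_0_off:
  assumes "a \<le> b" "c \<le> d" "rect a b c d \<subseteq> B" "box (Complex a c) (Complex b d) \<inter> K = {}"
  shows "rect_integral f a b c d = 0"
proof (rule rect_integral_eq_0)
  show "continuous_on (rect a b c d) f"
    using cont assms(3) continuous_on_subset by blast
  have "box (Complex a c) (Complex b d) \<subseteq> B - K"
    using assms(3,4) box_subset_cbox[of "Complex a c" "Complex b d"] by (auto simp: rect_def)
  then show "f holomorphic_on box (Complex a c) (Complex b d)"
    using holo holomorphic_on_subset by blast
qed (use assms in auto)

text \<open>\<open>norm_rect_integral_approx\<close> with slope 0, \<open>\<kappa> = N\<close> and
  \<open>C = 0\<close>: the strips contribute nothing because \<open>f\<close> is holomorphic inside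
  them. For bounded aspect ratio the squared half-perimeter is comparable to the area.\<close>

lemma norm_rect_integral_near_square:
  assumes R: "a \<le> b" "c \<le> d" "rect a b c d \<subseteq> B"
    and aspect: "b - a \<le> 2 * (d - c)" "d - c \<le> 2 * (b - a)"
  shows "norm (rect_integral f a b c d) \<le> 24 * N * ((b - a) * (d - c))"
proof (cases "K \<inter> rect a b c d = {}")
  case True
  then have "rect_integral f a b c d = 0"
    using R box_subset_cbox[of "Complex a c" "Complex b d"]
    by (intro rect_integral_eq_0_off) (auto simp: rect_def)
  then show ?thesis using R N by simp
next
  case False
  have "norm (rect_integral f a b c d) \<le> 4 * N * ((b - a) + (d - c))\<^sup>2"
  proof -
    have "norm (rect_integral f a b c d) \<le> 4 * N * ((b - a) + (d - c))\<^sup>2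
        + 0 * measure lebesgue (rect a b c d - K \<inter> rect a b c d)"
    proof (rule norm_rect_integral_approx[OF R(1,2) _ N, where s = 0])
      show "continuous_on (rect a b c d) f" using cont R(3) continuous_on_subset by blast
      fix p q r s assume *: "p \<le> q" "r \<le> s" "rect p q r s \<subseteq> rect a b c d"
        "box (Complex p r) (Complex q s) \<inter> (K \<inter> rect a b c d) = {}"
      then have "box (Complex p r) (Complex q s) \<inter> K = {}"
        using box_subset_cbox[of "Complex p r" "Complex q s"] by (auto simp: rect_def)
      then show "norm (rect_integral f p q r s) \<le> 0 * ((q - p) * (s - r))"
        using * R(3) by (simp add: rect_integral_eq_0_off)
    next
      fix z w assume *: "z \<in> K \<inter> rect a b c d" "w \<in> rect a b c d" "Re w = Re z \<or> Im w = Im z"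
      then show "norm (f w - f z - 0 * (w - z)) \<le> N * norm (w - z)"
        using lip[of z w] R(3) by auto
    qed (use False closedK in \<open>auto simp: closed_Int_compact\<close>)
    then show ?thesis by simp
  qed
  \<comment> \<open>Each of the two squares is at most twice the area, and the mixed term is exactly
    twice the area.\<close>
  also have "((b - a) + (d - c))\<^sup>2 \<le> 6 * ((b - a) * (d - c))"
  proof -
    have "(b - a) * (b - a) \<le> (b - a) * (2 * (d - c))" "(d - c) * (d - c) \<le> (2 * (b - a)) * (d - c)"
      using R aspect by (intro mult_left_mono mult_right_mono; simp)+
    then show ?thesis by (simp add: power2_eq_square algebra_simps)
  qed
  finally show ?thesis using N by (simp add: mult_left_mono)
qed

text \<open>For thin rectangles the squared half-perimeter is not controlled by the area. Halving
  the longer side until the aspect ratio is at most 2 removes this obstacle, and a bound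
  proportional to the area adds up without loss. The induction is on an exponent \<open>n\<close>
  bounding the aspect ratio by \<open>2 ^ n\<close>.\<close>

lemma norm_rect_integral_le_area:
  assumes R: "a \<le> b" "c \<le> d" "rect a b c d \<subseteq> B"
  shows "norm (rect_integral f a b c d) \<le> 24 * N * ((b - a) * (d - c))"
proof -
  have *: "norm (rect_integral f a b c d) \<le> 24 * N * ((b - a) * (d - c))"
    if "a \<le> b" "c \<le> d" "rect a b c d \<subseteq> B" "b - a \<le> 2 ^ n * (d - c)" "d - c \<le> 2 ^ n * (b - a)"
    for n a b c d
    using that
  proof (induction n arbitrary: a b c d)
    case 0
    then show ?case by (intro norm_rect_integral_near_square) auto
  next
    case (Suc n)
    have contR: "continuous_on (rect a b c d) f"
      using cont Suc.prems(3) continuous_on_subset by blast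
    have ge1: "(1::real) \<le> 2 ^ n" by simp
    show ?case
    proof (cases "b - a \<le> 2 * (d - c)")
      case False
      define x where "x = (a + b) / 2"
      have x: "a \<le> x" "x \<le> b" "x - a = (b - a) / 2" "b - x = (b - a) / 2"
        using Suc.prems by (auto simp: x_def field_simps)
      have sub: "rect a x c d \<subseteq> B" "rect x b c d \<subseteq> B"
        using Suc.prems(3) x by (auto simp: mem_rect)
      have "1 * ((b - a) / 2) \<le> 2 ^ n * ((b - a) / 2)"
        using Suc.prems by (intro mult_right_mono ge1) auto
      then have h: "d - c \<le> 2 ^ n * ((b - a) / 2)" "(b - a) / 2 \<le> 2 ^ n * (d - c)"
        using False Suc.prems by auto
      have "norm (rect_integral f a x c d) \<le> 24 * N * ((x - a) * (d - c))"
        "norm (rect_integral f x b c d) \<le> 24 * N * ((b - x) * (d - c))"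
        by (rule Suc.IH[OF x(1) Suc.prems(2) sub(1)] Suc.IH[OF x(2) Suc.prems(2) sub(2)];
            use h in \<open>simp only: x\<close>)+
      then have "norm (rect_integral f a x c d + rect_integral f x b c d)
        \<le> 24 * N * ((x - a) * (d - c)) + 24 * N * ((b - x) * (d - c))"
        by (rule norm_triangle_mono)
      also have "\<dots> = 24 * N * ((b - a) * (d - c))" by (simp add: algebra_simps)
      finally show ?thesis
        using rect_integral_split_Re[OF x(1,2) _ contR] Suc.prems by simp
    next
      case True
      show ?thesis
      proof (cases "d - c \<le> 2 * (b - a)")
        case True
        with \<open>b - a \<le> 2 * (d - c)\<close> show ?thesis
          using Suc.prems by (intro norm_rect_integral_near_square) auto
      next
        case False
        define y where "y = (c + d) / 2"
        have y: "c \<le> y" "y \<le> d" "y - c = (d - c) / 2" "d - y = (d - c) / 2"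
          using Suc.prems by (auto simp: y_def field_simps)
        have sub: "rect a b c y \<subseteq> B" "rect a b y d \<subseteq> B"
          using Suc.prems(3) y by (auto simp: mem_rect)
        have "1 * ((d - c) / 2) \<le> 2 ^ n * ((d - c) / 2)"
          using Suc.prems by (intro mult_right_mono ge1) auto
        then have h: "b - a \<le> 2 ^ n * ((d - c) / 2)" "(d - c) / 2 \<le> 2 ^ n * (b - a)"
          using False Suc.prems by auto
        have "norm (rect_integral f a b c y) \<le> 24 * N * ((b - a) * (y - c))"
          "norm (rect_integral f a b y d) \<le> 24 * N * ((b - a) * (d - y))"
          by (rule Suc.IH[OF Suc.prems(1) y(1) sub(1)] Suc.IH[OF Suc.prems(1) y(2) sub(2)];
              use h in \<open>simp only: y\<close>)+
        then have "norm (rect_integral f a b c y + rect_integral f a b y d)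
          \<le> 24 * N * ((b - a) * (y - c)) + 24 * N * ((b - a) * (d - y))"
          by (rule norm_triangle_mono)
        also have "\<dots> = 24 * N * ((b - a) * (d - c))" by (simp add: algebra_simps)
        finally show ?thesis
          using rect_integral_split_Im[OF _ y(1,2) contR] Suc.prems by simp
      qed
    qed
  qed
  show ?thesis
  proof (cases "a < b \<and> c < d")
    case True
    obtain n where n: "max ((b - a) / (d - c)) ((d - c) / (b - a)) < 2 ^ n"
      using real_arch_pow[of 2 "max ((b - a) / (d - c)) ((d - c) / (b - a))"] by auto
    then have "(b - a) / (d - c) < 2 ^ n" "(d - c) / (b - a) < 2 ^ n" by auto
    then have "b - a \<le> 2 ^ n * (d - c)" "d - c \<le> 2 ^ n * (b - a)"
      using True by (simp_all add: pos_divide_less_eq less_imp_le)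
    then show ?thesis by (rule *[OF R])
  next
    case False
    then have "rect_integral f a b c d = 0"
      using R by (intro rect_integral_eq_0_off) (auto simp: in_box_complex_iff)
    then show ?thesis using R N by simp
  qed
qed

end

section \<open>Morera's theorem for rectangles\<close>

text \<open>Rectangles anchored at the lower left corner suffice: they make the two L-shaped paths
  from this corner to a point give the same primitive \<open>F\<close>. Then \<open>f\<close> is the
  derivative of a holomorphic function.\<close>

lemma holomorphic_on_box_rect_integral:
  assumes "a \<le> b" "c \<le> d" and f: "continuous_on (rect a b c d) f"
    and zero: "\<And>x y. \<lbrakk>a \<le> x; x \<le> b; c \<le> y; y \<le> d\<rbrakk> \<Longrightarrow> rect_integral f a x c y = 0"
  shows "f holomorphic_on box (Complex a c) (Complex b d)"
proof -
  define J where "J = (\<lambda>z w. contour_integral (linepath z w) f)"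
  have cont: "continuous_on (closed_segment z w) f" if "z \<in> rect a b c d" "w \<in> rect a b c d" for z w
    using closed_segment_subset_rect[OF that] f continuous_on_subset by blast
  have rev: "J w z = - J z w" if "z \<in> rect a b c d" "w \<in> rect a b c d" for z w
    unfolding J_def by (intro contour_integral_reverse_linepath cont that)
  have spl: "J z w = J z v + J v w"
    if "z \<in> rect a b c d" "w \<in> rect a b c d" "v \<in> closed_segment z w" for z v w
    unfolding J_def by (intro contour_integral_split_linepath cont that)
  have JRe: "J (Complex x y) (Complex x' y) = J (Complex a y) (Complex x' y) - J (Complex a y) (Complex x y)"
    if "a \<le> x" "x \<le> b" "a \<le> x'" "x' \<le> b" "c \<le> y" "y \<le> d" for x x' y
  proof (cases "x \<le> x'")
    case True
    then show ?thesis using that spl[of "Complex a y" "Complex x' y" "Complex x y"]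
      by (simp add: mem_rect closed_segment_same_Im closed_segment_eq_real_ivl)
  next
    case False
    then show ?thesis using that spl[of "Complex a y" "Complex x y" "Complex x' y"]
        rev[of "Complex x' y" "Complex x y"]
      by (simp add: mem_rect closed_segment_same_Im closed_segment_eq_real_ivl)
  qed
  have JIm: "J (Complex x y) (Complex x y') = J (Complex x c) (Complex x y') - J (Complex x c) (Complex x y)"
    if "c \<le> y" "y \<le> d" "c \<le> y'" "y' \<le> d" "a \<le> x" "x \<le> b" for x y y'
  proof (cases "y \<le> y'")
    case True
    then show ?thesis using that spl[of "Complex x c" "Complex x y'" "Complex x y"]
      by (simp add: mem_rect closed_segment_same_Re closed_segment_eq_real_ivl)
  next
    case False
    then show ?thesis using that spl[of "Complex x c" "Complex x y" "Complex x y'"]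
        rev[of "Complex x y'" "Complex x y"]
      by (simp add: mem_rect closed_segment_same_Re closed_segment_eq_real_ivl)
  qed
  \<comment> \<open>\<open>F\<close> integrates along the bottom side first and vertically
    afterwards; \<open>F2\<close> turns this into the vertical-first path by the vanishing of the
    rectangle integral.\<close>
  define F where "F = (\<lambda>z. J (Complex a c) (Complex (Re z) c) + J (Complex (Re z) c) z)"
  have F2: "F (Complex x y) = J (Complex a c) (Complex a y) + J (Complex a y) (Complex x y)"
    if "a \<le> x" "x \<le> b" "c \<le> y" "y \<le> d" for x y
  proof -
    have "J (Complex a c) (Complex x c) + J (Complex x c) (Complex x y)
        + J (Complex x y) (Complex a y) + J (Complex a y) (Complex a c) = 0"
      using zero[OF that] by (simp add: rect_integral_def J_def)
    moreover have "J (Complex a y) (Complex a c) = - J (Complex a c) (Complex a y)"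
      "J (Complex x y) (Complex a y) = - J (Complex a y) (Complex x y)"
      using that assms(1,2) by (auto intro!: rev simp: mem_rect)
    ultimately show ?thesis by (simp add: F_def algebra_simps)
  qed
  \<comment> \<open>The vertical increment is read off from the definition of \<open>F\<close>, the
    horizontal one from the other path in \<open>F2\<close>.\<close>
  have Fdiff: "F w' - F w = J w (Complex (Re w') (Im w)) + J (Complex (Re w') (Im w)) w'"
    if "w \<in> rect a b c d" "w' \<in> rect a b c d" for w w'
  proof -
    have ineq: "a \<le> Re w" "Re w \<le> b" "c \<le> Im w" "Im w \<le> d"
      "a \<le> Re w'" "Re w' \<le> b" "c \<le> Im w'" "Im w' \<le> d" using that by (auto simp: mem_rect)
    have "F w' - F (Complex (Re w') (Im w)) = J (Complex (Re w') (Im w)) w'"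
      using JIm[of "Im w" "Im w'" "Re w'"] ineq by (simp add: F_def)
    moreover have "F (Complex (Re w') (Im w)) - F (Complex (Re w) (Im w)) = J w (Complex (Re w') (Im w))"
      using JRe[of "Re w" "Re w'" "Im w"] F2[of "Re w'" "Im w"] F2[of "Re w" "Im w"] ineq by simp
    ultimately show ?thesis by (simp add: algebra_simps)
  qed
  have deriv: "(F has_field_derivative f w) (at w)" if w: "w \<in> box (Complex a c) (Complex b d)" for w
    unfolding has_field_derivative_def has_derivative_at2 
  proof (intro conjI tendstoI bounded_linear_mult_right)
    fix e :: real assume "e > 0"
    have wR: "w \<in> rect a b c d"
      using w box_subset_cbox by (auto simp: rect_def)
    obtain \<delta>1 where \<delta>1: "\<delta>1 > 0" "ball w \<delta>1 \<subseteq> rect a b c d"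
      using w open_box open_contains_ball box_subset_cbox unfolding rect_def by (metis subset_trans)
    \<comment> \<open>Each of the two legs from \<open>w\<close> to \<open>w'\<close> has length at
      most \<open>norm (w' - w)\<close>, so the tolerance \<open>e / 4\<close> leaves
      \<open>e / 2\<close> in total, strictly below \<open>e\<close>.\<close>
    obtain \<delta>2 where \<delta>2: "\<delta>2 > 0" "\<And>u. u \<in> rect a b c d \<Longrightarrow> dist u w < \<delta>2 \<Longrightarrow> dist (f u) (f w) < e / 4"
      using f wR \<open>e > 0\<close> unfolding continuous_on_iff by (metis zero_less_divide_iff zero_less_numeral)
    have "dist ((1 / norm (w' - w)) *\<^sub>R (F w' - (F w + f w * (w' - w)))) 0 < e"
      if "w' \<noteq> w" "dist w' w < min \<delta>1 \<delta>2" for w'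
    proof -
      define v where "v = Complex (Re w') (Im w)"
      have nv: "norm (v - w) \<le> norm (w' - w)" "norm (w' - v) \<le> norm (w' - w)"
        using abs_Re_le_cmod[of "w' - w"] abs_Im_le_cmod[of "w' - w"] by (auto simp: v_def cmod_def)
      have near: "norm (u - w) \<le> norm (w' - w)" if "u \<in> closed_segment w v \<union> closed_segment v w'" for u
      proof -
        have "closed_segment w v \<union> closed_segment v w' \<subseteq> cball w (norm (w' - w))"
          using nv by (intro Un_least closed_segment_subset) (auto simp: dist_norm norm_minus_commute)
        with that show ?thesis by (auto simp: dist_norm norm_minus_commute)
      qed
      have inR: "u \<in> rect a b c d" if "norm (u - w) \<le> norm (w' - w)" for u
        using \<delta>1 that \<open>dist w' w < min \<delta>1 \<delta>2\<close> by (auto simp: dist_norm norm_minus_commute subset_iff)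
      have bd: "norm (f u - f w) \<le> e / 4" if "u \<in> closed_segment w v \<union> closed_segment v w'" for u
        using \<delta>2(2)[of u] near[OF that] inR[of u] \<open>dist w' w < min \<delta>1 \<delta>2\<close> by (auto simp: dist_norm)
      have est: "norm (J p q - f w * (q - p)) \<le> e / 4 * norm (q - p)"
        if "p \<in> rect a b c d" "q \<in> rect a b c d" "closed_segment p q \<subseteq> closed_segment w v \<union> closed_segment v w'" for p q
      proof -
        have "((\<lambda>u. f u - f w) has_contour_integral (J p q - f w * (q - p))) (linepath p q)"
          unfolding J_def using that
          by (intro has_contour_integral_diff has_contour_integral_const_linepath
              has_contour_integral_integral contour_integrable_continuous_linepath cont)
        then show ?thesis
          by (rule has_contour_integral_bound_linepath) (use \<open>e > 0\<close> bd that in auto)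
      qed
      have "F w' - (F w + f w * (w' - w)) = (J w v - f w * (v - w)) + (J v w' - f w * (w' - v))"
        using Fdiff[of w w'] wR inR by (simp add: v_def algebra_simps)
      also have "norm \<dots> \<le> e / 4 * norm (v - w) + e / 4 * norm (w' - v)"
        using inR nv wR by (intro norm_triangle_mono est) auto
      also have "\<dots> \<le> e / 4 * norm (w' - w) + e / 4 * norm (w' - w)"
        using nv \<open>e > 0\<close> by (intro add_mono mult_left_mono) auto
      finally have "norm (F w' - (F w + f w * (w' - w))) \<le> e / 2 * norm (w' - w)" by simp
      then have "norm (F w' - (F w + f w * (w' - w))) / norm (w' - w) \<le> e / 2"
        using that by (simp add: divide_le_eq)
      then have "norm (F w' - (F w + f w * (w' - w))) / norm (w' - w) < e"
        using \<open>e > 0\<close> by linarith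
      then show ?thesis by simp
    qed
    then show "\<forall>\<^sub>F w' in at w. dist ((1 / norm (w' - w)) *\<^sub>R (F w' - (F w + f w * (w' - w)))) 0 < e"
      using \<delta>1(1) \<delta>2(1) unfolding eventually_at by (intro exI[of _ "min \<delta>1 \<delta>2"]) auto
  qed
  then have "F holomorphic_on box (Complex a c) (Complex b d)"
    using holomorphic_on_open open_box by blast
  then have "deriv F holomorphic_on box (Complex a c) (Complex b d)"
    by (rule holomorphic_deriv) (rule open_box)
  then show ?thesis
    by (rule holomorphic_transform) (use deriv DERIV_imp_deriv in blast)
qed

section \<open>Derivatives along the coordinate axes\<close>

text \<open>Existence of both partial derivatives together with the Cauchy-Riemann equations:
  dividing the vertical increment by \<open>\<i> * of_real t\<close> makes both limits the same
  number.\<close>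

definition has_axis_deriv :: "(complex \<Rightarrow> complex) \<Rightarrow> complex \<Rightarrow> complex \<Rightarrow> bool" where
  "has_axis_deriv f z s \<longleftrightarrow>
     ((\<lambda>t::real. (f (z + of_real t) - f z) / of_real t) \<longlongrightarrow> s) (at 0) \<and>
     ((\<lambda>t::real. (f (z + \<i> * of_real t) - f z) / (\<i> * of_real t)) \<longlongrightarrow> s) (at 0)"

text \<open>Uniform version of the difference quotient condition, with fixed slope, tolerance and
  radius. Slope 0 gives the Lipschitz bound for Baire's theorem; varying slopes with small
  \<open>\<epsilon>\<close> give the fine approximation. Restricting \<open>x\<close> and
  \<open>y\<close> to the sides of the rectangle keeps the set closed when \<open>f\<close> is
  continuous merely there.\<close>

definition axis_approx ::
  "(complex \<Rightarrow> complex) \<Rightarrow> real \<Rightarrow> real \<Rightarrow> real \<Rightarrow> real \<Rightarrow> complex \<Rightarrow> real \<Rightarrow> real \<Rightarrow> complex set" where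
  "axis_approx f a b c d s \<epsilon> r = {z.
     (\<forall>x\<in>{a..b}. \<bar>x - Re z\<bar> < r \<longrightarrow>
        norm (f (Complex x (Im z)) - f z - s * of_real (x - Re z)) \<le> \<epsilon> * \<bar>x - Re z\<bar>) \<and>
     (\<forall>y\<in>{c..d}. \<bar>y - Im z\<bar> < r \<longrightarrow>
        norm (f (Complex (Re z) y) - f z - s * (\<i> * of_real (y - Im z))) \<le> \<epsilon> * \<bar>y - Im z\<bar>)}"

lemma axis_approxD:
  assumes "z \<in> axis_approx f a b c d s \<epsilon> r" "w \<in> rect a b c d" "norm (w - z) < r"
    "Re w = Re z \<or> Im w = Im z"
  shows "norm (f w - f z - s * (w - z)) \<le> \<epsilon> * norm (w - z)"
  using assms(4)
proof
  assume "Re w = Re z"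
  then have "w = Complex (Re z) (Im w)" "w - z = \<i> * of_real (Im w - Im z)"
    "norm (w - z) = \<bar>Im w - Im z\<bar>"
    by (auto simp: complex_eq_iff cmod_eq_Im)
  with assms(1-3) show ?thesis by (auto simp: axis_approx_def mem_rect)
next
  assume "Im w = Im z"
  then have "w = Complex (Re w) (Im z)" "w - z = of_real (Re w - Re z)"
    "norm (w - z) = \<bar>Re w - Re z\<bar>"
    by (auto simp: complex_eq_iff cmod_eq_Re)
  with assms(1-3) show ?thesis by (auto simp: axis_approx_def mem_rect)
qed

lemma axis_approx_mono:
  assumes "\<epsilon> \<le> \<epsilon>'" "r' \<le> r"
  shows "axis_approx f a b c d s \<epsilon> r \<subseteq> axis_approx f a b c d s \<epsilon>' r'"
proof -
  have "\<epsilon> * \<bar>t\<bar> \<le> \<epsilon>' * \<bar>t\<bar>" for t using assms by (intro mult_right_mono) auto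
  then show ?thesis using assms(2) unfolding axis_approx_def
    by (smt (verit, best) Collect_mono_iff)
qed

text \<open>The slope may differ from the derivative by less than \<open>\<epsilon>\<close>; hence
  countably many slopes will do.\<close>

lemma axis_approx_ex:
  assumes "has_axis_deriv f z s0" "norm (s0 - s) < \<epsilon>"
  shows "\<exists>r>0. z \<in> axis_approx f a b c d s \<epsilon> r"
proof -
  define e where "e = \<epsilon> - norm (s0 - s)"
  have "e > 0" using assms(2) by (simp add: e_def)
  then have "\<forall>\<^sub>F t in at 0. dist ((f (z + of_real t) - f z) / of_real t) s0 < e"
    "\<forall>\<^sub>F t in at 0. dist ((f (z + \<i> * of_real t) - f z) / (\<i> * of_real t)) s0 < e"
    using assms(1) by (auto simp: has_axis_deriv_def intro: tendstoD)
  then have "\<forall>\<^sub>F t in at 0. dist ((f (z + of_real t) - f z) / of_real t) s0 < e \<and>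
      dist ((f (z + \<i> * of_real t) - f z) / (\<i> * of_real t)) s0 < e"
    by (rule eventually_conj)
  then obtain r where r: "r > 0" "\<And>t. t \<noteq> 0 \<Longrightarrow> \<bar>t\<bar> < r \<Longrightarrow>
      dist ((f (z + of_real t) - f z) / of_real t) s0 < e \<and>
      dist ((f (z + \<i> * of_real t) - f z) / (\<i> * of_real t)) s0 < e"
    unfolding eventually_at by (auto simp: dist_real_def)
  have *: "norm (A - s * v) \<le> \<epsilon> * norm v" if "dist (A / v) s0 < e" "v \<noteq> 0" for A v
  proof -
    have "norm (A / v - s) \<le> norm (A / v - s0) + norm (s0 - s)"
      by (metis diff_add_cancel add_diff_eq norm_triangle_ineq)
    then have "norm (A / v - s) * norm v \<le> \<epsilon> * norm v"
      using that by (intro mult_right_mono) (auto simp: e_def dist_norm)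
    then show ?thesis using that(2) by (simp add: left_diff_distrib flip: norm_mult)
  qed
  have "norm (f (Complex x (Im z)) - f z - s * of_real (x - Re z)) \<le> \<epsilon> * \<bar>x - Re z\<bar>"
    if "\<bar>x - Re z\<bar> < r" for x
  proof (cases "x = Re z")
    case False
    have "z + of_real (x - Re z) = Complex x (Im z)" by (simp add: complex_eq_iff)
    then show ?thesis
      using *[of "f (Complex x (Im z)) - f z" "of_real (x - Re z)"] r(2)[of "x - Re z"] that False
      by (auto simp del: of_real_diff)
  qed simp
  moreover have "norm (f (Complex (Re z) y) - f z - s * (\<i> * of_real (y - Im z))) \<le> \<epsilon> * \<bar>y - Im z\<bar>"
    if "\<bar>y - Im z\<bar> < r" for y
  proof (cases "y = Im z")
    case False
    have "z + \<i> * of_real (y - Im z) = Complex (Re z) y" by (simp add: complex_eq_iff)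
    then show ?thesis
      using *[of "f (Complex (Re z) y) - f z" "\<i> * of_real (y - Im z)"] r(2)[of "y - Im z"] that False
      by (auto simp: norm_mult simp del: of_real_diff)
  qed simp
  ultimately show ?thesis using r(1) by (auto simp: axis_approx_def)
qed

text \<open>For each fixed \<open>x\<close> the implication is a union of two closed conditions on
  \<open>z\<close>, namely being at distance at least \<open>r\<close> or satisfying the estimate.
  The set is an intersection of such sets.\<close>

lemma closed_axis_approx:
  assumes f: "continuous_on (rect a b c d) f" and S: "closed S" "S \<subseteq> rect a b c d"
  shows "closed (S \<inter> axis_approx f a b c d s \<epsilon> r)"
proof -
  define A where "A = (\<lambda>x. {z \<in> S. r \<le> \<bar>x - Re z\<bar>} \<union>
    {z \<in> S. norm (f (Complex x (Im z)) - f z - s * of_real (x - Re z)) \<le> \<epsilon> * \<bar>x - Re z\<bar>})"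
  define A' where "A' = (\<lambda>y. {z \<in> S. r \<le> \<bar>y - Im z\<bar>} \<union>
    {z \<in> S. norm (f (Complex (Re z) y) - f z - s * (\<i> * of_real (y - Im z))) \<le> \<epsilon> * \<bar>y - Im z\<bar>})"
  have fS: "continuous_on S f" using f S(2) continuous_on_subset by blast
  have Com: "continuous_on S (\<lambda>z. Complex x (Im z))" "continuous_on S (\<lambda>z. Complex (Re z) y)" for x y
    unfolding Complex_eq by (intro continuous_intros)+
  have "closed (A x)" if "x \<in> {a..b}" for x
  proof -
    have "continuous_on S (\<lambda>z. f (Complex x (Im z)))"
      by (rule continuous_on_compose2[OF f Com(1)]) (use S(2) that in \<open>auto simp: mem_rect subset_iff\<close>)
    then show ?thesis unfolding A_def
      by (intro closed_Un continuous_on_closed_Collect_le S continuous_intros fS)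
  qed
  moreover have "closed (A' y)" if "y \<in> {c..d}" for y
  proof -
    have "continuous_on S (\<lambda>z. f (Complex (Re z) y))"
      by (rule continuous_on_compose2[OF f Com(2)]) (use S(2) that in \<open>auto simp: mem_rect subset_iff\<close>)
    then show ?thesis unfolding A'_def
      by (intro closed_Un continuous_on_closed_Collect_le S continuous_intros fS)
  qed
  moreover have "S \<inter> axis_approx f a b c d s \<epsilon> r = S \<inter> (\<Inter>x\<in>{a..b}. A x) \<inter> (\<Inter>y\<in>{c..d}. A' y)"
    by (auto simp: axis_approx_def A_def A'_def imp_conv_disj not_less)
  ultimately show ?thesis using S(1) by (auto intro!: closed_Int closed_INT)
qed

section \<open>Approximation of compact sets in measure\<close>

lemma ex_common_lower_bound:
  fixes r :: "nat \<Rightarrow> real"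
  assumes "\<And>i. i < L \<Longrightarrow> 0 < r i"
  shows "\<exists>\<delta>>0. \<forall>i<L. \<delta> \<le> r i"
proof (cases "L = 0")
  case False
  then have "0 < Min (r ` {..<L})"
    using assms by (subst Min_gr_iff) (auto simp: lessThan_empty_iff)
  then show ?thesis by (intro exI[of _ "Min (r ` {..<L})"]) auto
qed (auto intro: exI[of _ 1])

text \<open>Make the cover disjoint, replace each piece by a closed subset of almost full measure,
  and keep finitely many of them. Disjointness of compact sets gives positive distances, so that a
  small rectangle meets at most one of them.\<close>

lemma compact_disjoint_approx:
  fixes K :: "complex set" and D :: "nat \<Rightarrow> complex set"
  assumes K: "compact K" "K = (\<Union>i. D i)" and D: "\<And>i. closed (D i)" and "\<eta> > 0"
  obtains S and L :: nat where "\<And>i. compact (S i)" "\<And>i. S i \<subseteq> D i"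
    "\<And>i j. i \<noteq> j \<Longrightarrow> S i \<inter> S j = {}" "measure lebesgue (K - (\<Union>i<L. S i)) < \<eta>"
proof -
  have DK: "D i \<subseteq> K" for i using K by auto
  have "D i \<in> sets lebesgue" for i
    using D borel_closed by (auto intro: lborelD)
  then have Dl: "disjointed D i \<in> sets lebesgue" for i
    unfolding disjointed_def by (intro sets.Diff sets.finite_UN) auto
  \<comment> \<open>The tolerances sum to \<open>\<eta> / 2\<close>, which leaves room for the
    strict inequality after passing to a finite stage.\<close>
  have "\<exists>T. closed T \<and> T \<subseteq> disjointed D i
      \<and> emeasure lebesgue (disjointed D i - T) < ennreal (\<eta> / 2 * (1/2) ^ Suc i)" for i
  proof -
    have "0 < \<eta> / 2 * (1/2) ^ Suc i" using \<open>\<eta> > 0\<close> by simp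
    from sets_lebesgue_inner_closed[OF Dl this] show ?thesis by metis
  qed
  then obtain S where S: "\<And>i. closed (S i)" "\<And>i. S i \<subseteq> disjointed D i"
    "\<And>i. emeasure lebesgue (disjointed D i - S i) < ennreal (\<eta> / 2 * (1/2) ^ Suc i)"
    by metis
  have SK: "S i \<subseteq> K" for i using S(2)[of i] disjointed_subset[of D i] DK by blast
  have cS: "compact (S i)" for i using S(1) SK K(1) by (metis Int_absorb1 compact_Int_closed)
  have Sm: "S i \<in> lmeasurable" for i using cS lmeasurable_compact by blast
  have Km: "K \<in> lmeasurable" using K(1) lmeasurable_compact by blast
  \<comment> \<open>The remainders decrease to the part of \<open>K\<close> missed by all
    \<open>S i\<close>; continuity of measure from above yields the finite stage
    \<open>L\<close>.\<close>
  define A where "A = (\<lambda>n. K - (\<Union>i<n. S i))"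
  have Am: "A n \<in> lmeasurable" for n
    unfolding A_def using Sm Km by (intro fmeasurable.Diff fmeasurable.finite_UN) auto
  have "decseq A" unfolding A_def decseq_def by (auto intro: less_le_trans)
  then have lim: "(\<lambda>n. measure lebesgue (A n)) \<longlonglongrightarrow> measure lebesgue (\<Inter>n. A n)"
    using fmeasurableD[OF Am] fmeasurableD2[OF Am]
    by (intro Lim_measure_decseq) (auto simp del: emeasure_completion)
  have "(\<Inter>n. A n) \<subseteq> (\<Union>i. disjointed D i - S i)"
  proof
    fix z assume z: "z \<in> (\<Inter>n. A n)"
    then have "z \<in> K" by (auto simp: A_def)
    then obtain i where "z \<in> disjointed D i" using K(2) UN_disjointed_eq[of D] by blast
    moreover have "z \<notin> S i" using z by (auto simp: A_def)
    ultimately show "z \<in> (\<Union>i. disjointed D i - S i)" by auto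
  qed
  then have "emeasure lebesgue (\<Inter>n. A n) \<le> emeasure lebesgue (\<Union>i. disjointed D i - S i)"
    using Dl Sm by (intro emeasure_mono) (auto intro!: sets.countable_UN)
  also have "\<dots> \<le> (\<Sum>i. emeasure lebesgue (disjointed D i - S i))"
    using Dl Sm by (intro emeasure_subadditive_countably) auto
  also have "\<dots> \<le> (\<Sum>i. ennreal (\<eta> / 2 * (1/2) ^ Suc i))"
    using S(3) by (intro suminf_le) (auto intro: less_imp_le)
  also have "\<dots> = ennreal (\<eta> / 2)"
    using power_half_series \<open>\<eta> > 0\<close>
    by (intro suminf_ennreal_eq) (auto dest: sums_mult[of _ _ "\<eta> / 2"])
  finally have "measure lebesgue (\<Inter>n. A n) \<le> \<eta> / 2"
    unfolding measure_def using \<open>\<eta> > 0\<close> by (intro enn2real_leI) auto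
  then have "measure lebesgue (\<Inter>n. A n) < \<eta>" using \<open>\<eta> > 0\<close> by simp
  then have "\<forall>\<^sub>F n in sequentially. measure lebesgue (A n) < \<eta>"
    by (rule order_tendstoD(2)[OF lim])
  then obtain L where "measure lebesgue (A L) < \<eta>"
    by (auto simp: eventually_sequentially)
  moreover have "S i \<inter> S j = {}" if "i \<noteq> j" for i j
    using S(2) disjoint_family_disjointed[of D] that unfolding disjoint_family_on_def by blast
  moreover have "S i \<subseteq> D i" for i
    using S(2) disjointed_subset[of D] by (meson order_trans)
  ultimately show ?thesis
    using cS by (intro that[of S L]) (auto simp: A_def)
qed

text \<open>The closed neighbourhoods of radius \<open>1 / Suc n\<close> inside \<open>R\<close>
  decrease to \<open>K\<close>, so their measures converge to that of \<open>K\<close>.\<close>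

lemma compact_thickening:
  fixes K R :: "complex set"
  assumes K: "compact K" "K \<noteq> {}" "K \<subseteq> R" and R: "compact R" and "\<eta> > 0"
  obtains V \<delta> where "\<delta> > 0" "V \<in> lmeasurable" "K \<subseteq> V" "measure lebesgue V < measure lebesgue K + \<eta>"
    "\<And>z w. \<lbrakk>z \<in> K; w \<in> R; dist w z < \<delta>\<rbrakk> \<Longrightarrow> w \<in> V"
proof -
  define V where "V = (\<lambda>n::nat. {z \<in> R. infdist z K \<le> 1 / Suc n})"
  have "closed (V n)" for n
    unfolding V_def using R by (intro continuous_on_closed_Collect_le continuous_intros compact_imp_closed)
  then have "compact (V n)" for n
    using R compact_Int_closed[of R "V n"] by (simp add: V_def Int_def conj_left_absorb)
  then have Vm: "V n \<in> lmeasurable" for n by (rule lmeasurable_compact)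
  have "1 / real (Suc n) \<le> 1 / real (Suc m)" if "m \<le> n" for m n
    using that by (simp add: frac_le)
  then have "decseq V" unfolding decseq_def V_def
    by (blast intro: order_trans)
  then have lim: "(\<lambda>n. measure lebesgue (V n)) \<longlonglongrightarrow> measure lebesgue (\<Inter>n. V n)"
    using fmeasurableD[OF Vm] fmeasurableD2[OF Vm]
    by (intro Lim_measure_decseq) (auto simp del: emeasure_completion)
  have "(\<Inter>n. V n) = K"
  proof
    show "(\<Inter>n. V n) \<subseteq> K"
    proof
      fix z assume "z \<in> (\<Inter>n. V n)"
      then have le: "infdist z K \<le> 1 / Suc n" for n by (auto simp: V_def)
      have "infdist z K \<le> 0"
      proof (rule ccontr)
        assume "\<not> infdist z K \<le> 0"
        then obtain n where "1 / Suc n < infdist z K"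
          using nat_approx_posE[of "infdist z K"] by (metis not_le)
        with le[of n] show False by simp
      qed
      then show "z \<in> K"
        using in_closed_iff_infdist_zero[of K z] K compact_imp_closed infdist_nonneg[of z K] by auto
    qed
    show "K \<subseteq> (\<Inter>n. V n)" using K(3) by (auto simp: V_def)
  qed
  then have "\<forall>\<^sub>F n in sequentially. measure lebesgue (V n) < measure lebesgue K + \<eta>"
    using lim \<open>\<eta> > 0\<close> by (intro order_tendstoD(2)[OF lim]) auto
  then obtain n where n: "measure lebesgue (V n) < measure lebesgue K + \<eta>"
    by (auto simp: eventually_sequentially)
  show ?thesis
  proof (rule that[of "1 / Suc n" "V n"])
    show "w \<in> V n" if "z \<in> K" "w \<in> R" "dist w z < 1 / Suc n" for z w
      using that infdist_le[OF that(1), of w] by (auto simp: V_def)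
    show "K \<subseteq> V n" using K(3) by (auto simp: V_def)
  qed (use n Vm in auto)
qed

section \<open>Vanishing of the rectangle integrals\<close>

context holomorphic_off
begin

text \<open>On a fine grid, cells near the well approximated compact pieces of \<open>K\<close>
  contribute \<open>\<epsilon>\<close> times their area; everything else that matters lies in a set
  \<open>W\<close> of measure below \<open>2 * \<eta>\<close>, where the crude bound
  \<open>24 * N\<close> times area is enough.\<close>

lemma norm_rect_integral_le_eps:
  assumes R: "a < b" "c < d" "rect a b c d \<subseteq> B"
    and deriv: "\<And>z. z \<in> K \<inter> rect a b c d \<Longrightarrow> \<exists>s. has_axis_deriv f z s"
    and "\<epsilon> > 0" "\<eta> > 0"
  shows "norm (rect_integral f a b c d) \<le> 4 * \<epsilon> * ((b - a) + (d - c))\<^sup>2 + 24 * N * (2 * \<eta>)"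
proof (cases "K \<inter> rect a b c d = {}")
  case True
  then have "rect_integral f a b c d = 0"
    using R box_subset_cbox[of "Complex a c" "Complex b d"]
    by (intro rect_integral_eq_0_off) (auto simp: rect_def)
  then show ?thesis using R N \<open>\<epsilon> > 0\<close> \<open>\<eta> > 0\<close> by simp
next
  case False
  let ?K = "K \<inter> rect a b c d"
  have cK: "compact ?K" using closedK by (simp add: closed_Int_compact)
  have contR: "continuous_on (rect a b c d) f"
    using cont R(3) continuous_on_subset by blast
  obtain Q :: "complex set" where Q: "countable Q"
    "\<And>X. open X \<Longrightarrow> X \<noteq> {} \<Longrightarrow> \<exists>q\<in>Q. q \<in> X"
    using countable_dense_setE by metis
  \<comment> \<open>Slopes from a countable dense set and radii \<open>1 / Suc j\<close> give a
    countable closed cover of the singular set.\<close>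
  define T where "T = (\<lambda>(s, j::nat). ?K \<inter> axis_approx f a b c d s \<epsilon> (1 / Suc j))"
  define \<D> where "\<D> = T ` (Q \<times> UNIV)"
  have Qne: "Q \<noteq> {}" using Q(2)[of UNIV] by auto
  have cD: "countable \<D>" "\<D> \<noteq> {}" using Q(1) Qne by (auto simp: \<D>_def)
  \<comment> \<open>The enumeration may repeat members of the family, since it may be finite;
    \<open>compact_disjoint_approx\<close> makes the pieces disjoint afterwards.\<close>
  define D where "D = from_nat_into \<D>"
  have rD: "range D = \<D>" using cD by (simp add: D_def range_from_nat_into)
  have cover: "?K = (\<Union>i. D i)"
  proof
    show "?K \<subseteq> (\<Union>i. D i)"
    proof
      fix z assume z: "z \<in> ?K"
      then obtain s0 where s0: "has_axis_deriv f z s0" using deriv by blast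
      obtain s where s: "s \<in> Q" "s \<in> ball s0 \<epsilon>" using Q(2)[of "ball s0 \<epsilon>"] \<open>\<epsilon> > 0\<close> by auto
      then have "norm (s0 - s) < \<epsilon>" by (simp add: dist_norm)
      from axis_approx_ex[OF s0 this] obtain r
        where r: "r > 0" "z \<in> axis_approx f a b c d s \<epsilon> r" by blast
      obtain j where "1 / Suc j < r" using nat_approx_posE[OF r(1)] by metis
      then have "axis_approx f a b c d s \<epsilon> r \<subseteq> axis_approx f a b c d s \<epsilon> (1 / Suc j)"
        by (intro axis_approx_mono) auto
      then have "z \<in> T (s, j)"
        using z r(2) unfolding T_def by blast
      then show "z \<in> (\<Union>i. D i)" using s(1) unfolding rD \<D>_def by auto
    qed
    show "(\<Union>i. D i) \<subseteq> ?K" unfolding rD \<D>_def by (auto simp: T_def)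
  qed
  have Dex: "\<exists>s r. r > 0 \<and> D i \<subseteq> axis_approx f a b c d s \<epsilon> r" for i
  proof -
    have "D i \<in> \<D>" using rD by auto
    then obtain s j where "D i = T (s, j)" by (auto simp: \<D>_def)
    then show ?thesis by (intro exI[of _ s] exI[of _ "1 / Suc j"]) (auto simp: T_def)
  qed
  then obtain s r where sr: "\<And>i. r i > 0" "\<And>i. D i \<subseteq> axis_approx f a b c d (s i) \<epsilon> (r i)"
    by metis
  have Dcl: "closed (D i)" for i
  proof -
    have "D i \<in> \<D>" using rD by auto
    then show ?thesis using closed_axis_approx[OF contR compact_imp_closed[OF cK]]
      by (auto simp: \<D>_def T_def)
  qed
  obtain S L where S: "\<And>i. compact (S i)" "\<And>i. S i \<subseteq> D i" "\<And>i j. i \<noteq> j \<Longrightarrow> S i \<inter> S j = {}"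
    "measure lebesgue (?K - (\<Union>i<L. S i)) < \<eta>"
    using compact_disjoint_approx[OF cK cover Dcl \<open>\<eta> > 0\<close>] by metis
  define K' where "K' = (\<Union>i<L. S i)"
  have cK': "compact K'" unfolding K'_def using S(1) by (intro compact_UN) auto
  have K'K: "K' \<subseteq> ?K" using S(2) cover by (auto simp: K'_def)
  obtain V \<delta>V where V: "\<delta>V > 0" "V \<in> lmeasurable" "?K \<subseteq> V"
      "measure lebesgue V < measure lebesgue ?K + \<eta>"
      "\<And>z w. \<lbrakk>z \<in> ?K; w \<in> rect a b c d; dist w z < \<delta>V\<rbrakk> \<Longrightarrow> w \<in> V"
    by (rule compact_thickening[OF cK False Int_lower2 compact_rect \<open>\<eta> > 0\<close>]) (rule that)
  \<comment> \<open>\<open>V\<close> exceeds the singular set by less than \<open>\<eta>\<close> in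
    measure, and the pieces in \<open>K'\<close> exhaust it up to less than \<open>\<eta>\<close>;
    this gives the bound \<open>2 * \<eta>\<close>.\<close>
  define W where "W = V - K'"
  have Wm: "W \<in> lmeasurable"
    unfolding W_def by (intro fmeasurable.Diff V(2) lmeasurable_compact[OF cK'])
  have "measure lebesgue W = measure lebesgue V - measure lebesgue K'"
    unfolding W_def using V(2,3) K'K cK'
    by (intro measurable_measure_Diff) (auto intro: lmeasurable_compact fmeasurableD)
  moreover have "measure lebesgue (?K - K') = measure lebesgue ?K - measure lebesgue K'"
    using K'K cK' cK by (intro measurable_measure_Diff) (auto intro: lmeasurable_compact fmeasurableD)
  ultimately have mW: "measure lebesgue W < 2 * \<eta>"
    using V(4) S(4) by (simp add: K'_def)
  have "\<exists>\<delta>>0. \<forall>x\<in>S i. \<forall>y\<in>(\<Union>j\<in>{..<L} - {i}. S j). \<delta> \<le> dist x y" for i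
  proof -
    have "closed (\<Union>j\<in>{..<L} - {i}. S j)"
      using S(1) by (intro closed_UN) (auto intro: compact_imp_closed)
    moreover have "S i \<inter> (\<Union>j\<in>{..<L} - {i}. S j) = {}" using S(3)[of i] by (auto simp: Int_UN_distrib)
    ultimately show ?thesis by (rule separate_compact_closed[OF S(1)])
  qed
  then obtain sep where sep: "\<And>i. sep i > 0"
    "\<And>i x y. x \<in> S i \<Longrightarrow> y \<in> (\<Union>j\<in>{..<L} - {i}. S j) \<Longrightarrow> sep i \<le> dist x y"
    by metis
  obtain \<delta>1 where \<delta>1: "\<delta>1 > 0" "\<forall>i<L. \<delta>1 \<le> min (sep i) (r i)"
    using ex_common_lower_bound[of L "\<lambda>i. min (sep i) (r i)"] sep(1) sr(1) by auto
  \<comment> \<open>Cells of diameter below \<open>\<delta>\<close> meet at most one piece, stay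
    within the radius of approximation of that piece, and lie in \<open>V\<close> once they meet
    \<open>?K\<close>.\<close>
  define \<delta> where "\<delta> = min \<delta>1 \<delta>V"
  have "\<delta> > 0" using \<delta>1 V(1) by (simp add: \<delta>_def)
  define w0 h0 where "w0 = b - a" and "h0 = d - c"
  have wh: "w0 > 0" "h0 > 0" using R by (auto simp: w0_def h0_def)
  obtain n where n: "(w0 + h0) / \<delta> < 2 ^ n"
    using real_arch_pow[of 2 "(w0 + h0) / \<delta>"] by auto
  \<comment> \<open>All cells are similar to the original rectangle, so the squared half-perimeter
    is a fixed multiple of the area; with the constant \<open>A\<close> the bound \<open>P\<close>
    becomes additive under cutting.\<close>
  define A where "A = 4 * \<epsilon> * (w0 + h0)\<^sup>2 / (w0 * h0)"
  define P where "P = (\<lambda>p q r s. norm (rect_integral f p q r s)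
    \<le> A * ((q - p) * (s - r)) + 24 * N * measure lebesgue (rect p q r s \<inter> W))"
  have "P a b c d"
  proof (rule rect_bisect[where n = n])
    fix p x q u v assume *: "a \<le> p" "p \<le> x" "x \<le> q" "q \<le> b" "c \<le> u" "u \<le> v" "v \<le> d"
      "P p x u v" "P x q u v"
    have "continuous_on (rect p q u v) f"
      by (rule continuous_on_subset[OF contR]) (use * in \<open>auto simp: mem_rect\<close>)
    then have "norm (rect_integral f p q u v) \<le> norm (rect_integral f p x u v) + norm (rect_integral f x q u v)"
      using * rect_integral_split_Re by (simp add: norm_triangle_ineq)
    then show "P p q u v"
      using *(8,9) measure_rect_Int_split_Re[OF *(2,3) Wm, of u v] unfolding P_def
      by (simp add: algebra_simps)
  next
    fix p q u y v assume *: "a \<le> p" "p \<le> q" "q \<le> b" "c \<le> u" "u \<le> y" "y \<le> v" "v \<le> d"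
      "P p q u y" "P p q y v"
    have "continuous_on (rect p q u v) f"
      by (rule continuous_on_subset[OF contR]) (use * in \<open>auto simp: mem_rect\<close>)
    then have "norm (rect_integral f p q u v) \<le> norm (rect_integral f p q u y) + norm (rect_integral f p q y v)"
      using * rect_integral_split_Im by (simp add: norm_triangle_ineq)
    then show "P p q u v"
      using *(8,9) measure_rect_Int_split_Im[OF *(5,6) Wm, of p q] unfolding P_def
      by (simp add: algebra_simps)
  next
    fix p q u v assume *: "a \<le> p" "p \<le> q" "q \<le> b" "c \<le> u" "u \<le> v" "v \<le> d"
      "q - p = (b - a) / 2 ^ n" "v - u = (d - c) / 2 ^ n"
    have sub: "rect p q u v \<subseteq> rect a b c d" using * by (auto simp: mem_rect)
    then have subB: "rect p q u v \<subseteq> B" using R by blast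
    have "(q - p) + (v - u) = (w0 + h0) / 2 ^ n"
      using * by (simp add: w0_def h0_def add_divide_distrib)
    also have "\<dots> < \<delta>" using n \<open>\<delta> > 0\<close> by (simp add: field_simps)
    finally have diam: "(q - p) + (v - u) < \<delta>" .
    have dist: "dist x y < \<delta>" if "x \<in> rect p q u v" "y \<in> rect p q u v" for x y
    proof -
      have "norm (x - y) \<le> \<bar>Re x - Re y\<bar> + \<bar>Im x - Im y\<bar>" using cmod_le[of "x - y"] by simp
      also have "\<dots> \<le> (q - p) + (v - u)" using that by (auto simp: mem_rect)
      finally show ?thesis using diam by (simp add: dist_norm)
    qed
    have A: "4 * \<epsilon> * ((q - p) + (v - u))\<^sup>2 = A * ((q - p) * (v - u))"
      using wh unfolding A_def *(7,8) w0_def[symmetric] h0_def[symmetric]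
      by (simp add: field_simps power2_eq_square)
    have A0: "0 \<le> A * ((q - p) * (v - u))"
      using wh * \<open>\<epsilon> > 0\<close> by (simp add: A_def)
    \<comment> \<open>A cell free of \<open>?K\<close> has integral 0; a cell meeting some piece
      \<open>S i\<close> is handled with the slope \<open>s i\<close>; a cell meeting
      \<open>?K\<close> but no piece lies entirely in \<open>W\<close>.\<close>
    consider "?K \<inter> rect p q u v = {}" | i where "i < L" "S i \<inter> rect p q u v \<noteq> {}"
      | "?K \<inter> rect p q u v \<noteq> {}" "K' \<inter> rect p q u v = {}"
      by (auto simp: K'_def)
    then show "P p q u v"
    proof cases
      case 1
      then have "rect_integral f p q u v = 0"
        using * subB sub box_subset_cbox[of "Complex p u" "Complex q v"]
        by (intro rect_integral_eq_0_off) (auto simp: rect_def)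
      then show ?thesis using A0 N by (simp add: P_def)
    next
      case 2
      obtain z0 where z0: "z0 \<in> S i" "z0 \<in> rect p q u v" using 2 by blast
      have SiK: "S i \<subseteq> ?K" using 2(1) K'K by (auto simp: K'_def)
      have C: "norm (rect_integral f p q r s) \<le> 24 * N * ((q - p) * (s - r))"
        if "p \<le> q" "r \<le> s" "rect p q r s \<subseteq> B" for p q r s
        using norm_rect_integral_le_area that by blast
      have approx: "norm (f w - f z - s i * (w - z)) \<le> \<epsilon> * norm (w - z)"
        if "z \<in> S i" "z \<in> rect p q u v" "w \<in> rect p q u v" "Re w = Re z \<or> Im w = Im z" for z w
      proof (rule axis_approxD)
        show "z \<in> axis_approx f a b c d (s i) \<epsilon> (r i)" using that S(2) sr(2) by blast
        show "norm (w - z) < r i"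
          using dist[OF that(3,2)] \<delta>1(2) 2(1) by (auto simp: \<delta>_def dist_norm)
      qed (use that sub in auto)
      have contS: "continuous_on (rect p q u v) f" using contR sub continuous_on_subset by blast
      have "norm (rect_integral f p q u v) \<le> 4 * \<epsilon> * ((q - p) + (v - u))\<^sup>2
          + 24 * N * measure lebesgue (rect p q u v - S i)"
        by (rule norm_rect_integral_approx[OF *(2,5) contS _ _ S(1) 2(2), where s = "s i"])
           (use \<open>\<epsilon> > 0\<close> N subB C approx in auto)
      \<comment> \<open>The cell lies in \<open>V\<close> and is too small to meet any other piece,
        so outside \<open>S i\<close> it is contained in \<open>W\<close>.\<close>
      also have "measure lebesgue (rect p q u v - S i) \<le> measure lebesgue (rect p q u v \<inter> W)"
      proof (rule measure_mono_fmeasurable)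
        show "rect p q u v - S i \<subseteq> rect p q u v \<inter> W"
        proof
          fix y assume y: "y \<in> rect p q u v - S i"
          then have "dist y z0 < \<delta>" using dist z0 by blast
          then have "y \<in> V" using V(5)[of z0 y] z0 SiK y sub by (auto simp: \<delta>_def)
          moreover have "y \<notin> K'"
          proof
            assume "y \<in> K'"
            then have "y \<in> (\<Union>j\<in>{..<L} - {i}. S j)" using y by (auto simp: K'_def)
            then have "sep i \<le> dist z0 y" using sep(2) z0 by blast
            with \<open>dist y z0 < \<delta>\<close> \<delta>1(2) 2(1) show False by (auto simp: \<delta>_def dist_commute)
          qed
          ultimately show "y \<in> rect p q u v \<inter> W" using y by (auto simp: W_def)
        qed
        show "rect p q u v - S i \<in> sets lebesgue"
          by (intro sets.Diff fmeasurableD lmeasurable_compact S(1) compact_rect)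
        show "rect p q u v \<inter> W \<in> lmeasurable"
          using Wm by (simp add: rect_def fmeasurable.Int)
      qed
      finally show ?thesis using N by (simp add: P_def A mult_left_mono)
    next
      case 3
      then obtain z0 where z0: "z0 \<in> ?K" "z0 \<in> rect p q u v" by blast
      have "rect p q u v \<subseteq> W"
      proof
        fix y assume y: "y \<in> rect p q u v"
        then have "dist y z0 < \<delta>" using dist z0 by blast
        then have "y \<in> V" using V(5)[of z0 y] z0 y sub by (auto simp: \<delta>_def)
        then show "y \<in> W" using 3(2) y by (auto simp: W_def)
      qed
      then have "rect p q u v \<inter> W = rect p q u v" by blast
      then show ?thesis
        using norm_rect_integral_le_area[OF *(2,5) subB] * A0 by (simp add: P_def measure_rect)
    qed
  qed (use R in auto)
  then have "norm (rect_integral f a b c d)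
    \<le> A * (w0 * h0) + 24 * N * measure lebesgue (rect a b c d \<inter> W)"
    by (simp add: P_def w0_def h0_def)
  also have "A * (w0 * h0) = 4 * \<epsilon> * ((b - a) + (d - c))\<^sup>2"
    using wh unfolding A_def by (simp add: w0_def h0_def)
  also have "measure lebesgue (rect a b c d \<inter> W) \<le> measure lebesgue W"
    using Wm by (intro measure_mono_fmeasurable) (auto simp: rect_def fmeasurableD)
  finally show ?thesis using mW N
    by (smt (verit, ccfv_SIG) mult_left_mono)
qed

end

context holomorphic_off
begin

lemma rect_integral_eq_0_axis_deriv:
  assumes R: "a \<le> b" "c \<le> d" "rect a b c d \<subseteq> B"
    and deriv: "\<And>z. z \<in> K \<inter> rect a b c d \<Longrightarrow> \<exists>s. has_axis_deriv f z s"
  shows "rect_integral f a b c d = 0"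
proof (cases "a < b \<and> c < d")
  case False
  then show ?thesis
    using R by (intro rect_integral_eq_0_off) (auto simp: in_box_complex_iff)
next
  case True
  \<comment> \<open>Chosen so that the estimate with both tolerances equal to \<open>t\<close> reads
    \<open>t * M\<close>, which can be made arbitrarily small.\<close>
  define M where "M = 4 * ((b - a) + (d - c))\<^sup>2 + 48 * N"
  have "M > 0" using True N by (auto simp: M_def intro!: add_pos_nonneg)
  have "norm (rect_integral f a b c d) \<le> 0 + e" if "e > 0" for e
  proof -
    define t where "t = e / M"
    have t: "t > 0" "t * M = e" using that \<open>M > 0\<close> by (simp_all add: t_def)
    then have "norm (rect_integral f a b c d)
        \<le> 4 * t * ((b - a) + (d - c))\<^sup>2 + 24 * N * (2 * t)"
      using True by (intro norm_rect_integral_le_eps R(3) deriv) auto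
    also have "\<dots> = t * M" by (simp add: M_def algebra_simps)
    finally show ?thesis using t(2) by simp
  qed
  then show ?thesis using field_le_epsilon[of "norm (rect_integral f a b c d)" 0] by simp
qed

end

section \<open>Baire's theorem and the conclusion of Looman-Menchoff\<close>

text \<open>If no \<open>E n\<close> contained a nonempty relatively open part of \<open>K\<close>,
  the complements \<open>K - E n\<close> would be relatively open and dense in \<open>K\<close>, yet
  their intersection is empty.\<close>

lemma Baire_closed_cover:
  fixes K :: "complex set"
  assumes K: "closed K" "K \<noteq> {}" and E: "\<And>n::nat. closed (E n)" "K = (\<Union>n. E n)"
  obtains n V where "open V" "V \<inter> K \<noteq> {}" "V \<inter> K \<subseteq> E n"
proof -
  have "\<exists>n V. open V \<and> V \<inter> K \<noteq> {} \<and> V \<inter> K \<subseteq> E n"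
  proof (rule ccontr)
    assume no: "\<not> ?thesis"
    have "K \<subseteq> closure (\<Inter>(range (\<lambda>n. K - E n)))"
    proof (rule Baire[OF K(1)])
      fix T assume "T \<in> range (\<lambda>n. K - E n)"
      then obtain n where T: "T = K - E n" by auto
      have "openin (top_of_set K) T"
        using E(1)[of n] unfolding T by (metis Diff_eq open_Compl openin_open_Int)
      moreover have "K \<subseteq> closure T"
      proof
        fix z assume z: "z \<in> K"
        show "z \<in> closure T"
        proof (rule ccontr)
          assume "z \<notin> closure T"
          then have "- closure T \<inter> K \<noteq> {}" "- closure T \<inter> K \<subseteq> E n"
            using z closure_subset[of T] by (auto simp: T)
          then show False using no by (metis closed_closure open_Compl)
        qed
      qed
      ultimately show "openin (top_of_set K) T \<and> K \<subseteq> closure T" by blast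
    qed auto
    moreover have "\<Inter>(range (\<lambda>n. K - E n)) = {}" using E(2) by auto
    ultimately show False using K(2) by (metis closure_empty subset_empty)
  qed
  then show ?thesis using that by blast
qed

text \<open>\<open>W\<close> is the largest open subset of \<open>U\<close> on which
  \<open>f\<close> is holomorphic. If a point of \<open>U\<close> were missing, Baire's theorem
  would provide a missing point with a disc in which \<open>holomorphic_off\<close> applies, and
  Morera's theorem would put this point into \<open>W\<close>.\<close>

theorem Looman_Menchoff:
  assumes U: "open U" and f: "continuous_on U f"
    and deriv: "\<And>z. z \<in> U \<Longrightarrow> \<exists>s. has_axis_deriv f z s"
  shows "f holomorphic_on U"
proof -
  define \<V> where "\<V> = {V. open V \<and> V \<subseteq> U \<and> f holomorphic_on V}"
  define W where "W = \<Union>\<V>"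
  have "f holomorphic_on (\<Union>V\<in>\<V>. V)"
    by (rule holomorphic_on_UN_open) (simp_all add: \<V>_def)
  then have W: "open W" "f holomorphic_on W"
    unfolding W_def by (auto simp: \<V>_def)
  have "U \<subseteq> W"
  proof (rule ccontr)
    assume "\<not> U \<subseteq> W"
    then obtain z0 where z0: "z0 \<in> U" "z0 \<notin> W" by blast
    obtain \<rho> where \<rho>: "\<rho> > 0" "ball z0 \<rho> \<subseteq> U" using U z0(1) open_contains_ball by blast
    define h where "h = \<rho> / 4"
    define a b c d where "a = Re z0 - h" "b = Re z0 + h" "c = Im z0 - h" "d = Im z0 + h"
    have h: "h > 0" using \<rho> by (simp add: h_def)
    have RU: "rect a b c d \<subseteq> U"
    proof
      fix z assume "z \<in> rect a b c d"
      then have "\<bar>Re (z - z0)\<bar> + \<bar>Im (z - z0)\<bar> \<le> 2 * h"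
        by (auto simp: mem_rect a_b_c_d_def abs_le_iff)
      then have "norm (z - z0) \<le> 2 * h" using cmod_le[of "z - z0"] by linarith
      then show "z \<in> U" using \<rho> by (auto simp: h_def dist_norm norm_minus_commute subset_iff)
    qed
    have contR: "continuous_on (rect a b c d) f" using f RU continuous_on_subset by blast
    define Q where "Q = box (Complex a c) (Complex b d)"
    have Q: "open Q" "Q \<subseteq> rect a b c d" "z0 \<in> Q"
      using h box_subset_cbox by (auto simp: Q_def rect_def in_box_complex_iff a_b_c_d_def)
    \<comment> \<open>\<open>K\<close> is the closure of the singular points in the open box
      \<open>Q\<close>; any open set meeting \<open>K\<close> therefore contains a singular point
      interior to \<open>Q\<close>.\<close>
    define X where "X = Q - W"
    define K where "K = closure X"
    have "closed (rect a b c d - W)" using W(1) by (intro closed_Diff compact_imp_closed) auto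
    then have KR: "K \<subseteq> rect a b c d - W"
      unfolding K_def using Q(2) by (intro closure_minimal) (auto simp: X_def)
    have K: "closed K" "K \<noteq> {}" using Q(3) z0 closure_subset[of X] by (auto simp: K_def X_def)
    \<comment> \<open>One index serves as Lipschitz constant and, inverted, as radius; at each point
      a large enough index satisfies both requirements.\<close>
    define E where "E = (\<lambda>n::nat. K \<inter> axis_approx f a b c d 0 (Suc n) (1 / Suc n))"
    have cover: "K = (\<Union>n. E n)"
    proof
      show "K \<subseteq> (\<Union>n. E n)"
      proof
        fix z assume z: "z \<in> K"
        then obtain s where s: "has_axis_deriv f z s" using deriv KR RU by blast
        obtain n1 where n1: "norm s < real n1" using reals_Archimedean2 by blast
        then have "norm (s - 0) < real n1" by simp
        from axis_approx_ex[OF s this] obtain r where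
          r: "r > 0" "z \<in> axis_approx f a b c d 0 (real n1) r" by blast
        obtain n2 where n2: "1 / Suc n2 < r" using nat_approx_posE[OF r(1)] by metis
        have "1 / real (Suc (max n1 n2)) \<le> 1 / real (Suc n2)" by (simp add: frac_le)
        then have "axis_approx f a b c d 0 (real n1) r
            \<subseteq> axis_approx f a b c d 0 (real (Suc (max n1 n2))) (1 / real (Suc (max n1 n2)))"
          using n2 by (intro axis_approx_mono) auto
        then show "z \<in> (\<Union>n. E n)" using r(2) z unfolding E_def by blast
      qed
    qed (auto simp: E_def)
    have Ecl: "closed (E n)" for n
      unfolding E_def using K(1) KR by (intro closed_axis_approx contR) auto
    obtain n V where V: "open V" "V \<inter> K \<noteq> {}" "V \<inter> K \<subseteq> E n"
      by (rule Baire_closed_cover[OF K Ecl cover])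
    then have "V \<inter> X \<noteq> {}"
      unfolding K_def by (metis inf_commute open_Int_closure_eq_empty)
    then obtain z1 where z1: "z1 \<in> V" "z1 \<in> Q" "z1 \<notin> W" by (auto simp: X_def)
    have "open (V \<inter> Q)" using V(1) Q(1) by (rule open_Int)
    then obtain r0 where r0: "r0 > 0" "ball z1 r0 \<subseteq> V \<inter> Q"
      using z1 open_contains_ball by blast
    \<comment> \<open>Two points of the disc are then less than \<open>1 / Suc n\<close> apart,
      within the radius in \<open>E n\<close>.\<close>
    define r where "r = min r0 (1 / (2 * Suc n))"
    define B where "B = ball z1 r"
    have r: "r > 0" "r \<le> r0" "2 * r \<le> 1 / Suc n" using r0(1) by (auto simp: r_def min_def field_simps)
    have B: "B \<subseteq> V" "B \<subseteq> Q" using r0(2) r(2) by (auto simp: B_def)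
    interpret holomorphic_off f B K "real (Suc n)"
    proof
      show "continuous_on B f" using contR B Q continuous_on_subset by blast
      \<comment> \<open>All singular points of \<open>Q\<close> belong to \<open>K\<close>.\<close>
      have "B - K \<subseteq> W" using B(2) closure_subset[of X] by (auto simp: K_def X_def)
      then show "f holomorphic_on (B - K)" using W(2) holomorphic_on_subset by blast
      fix z w assume zw: "z \<in> K" "z \<in> B" "w \<in> B" "Re w = Re z \<or> Im w = Im z"
      have "norm (w - z) \<le> norm (w - z1) + norm (z1 - z)"
        by (metis diff_add_cancel add_diff_eq norm_triangle_ineq)
      also have "\<dots> < 1 / Suc n"
        using zw r(3) by (simp add: B_def dist_norm norm_minus_commute)
      finally have "norm (w - z) < 1 / Suc n" .
      moreover have "z \<in> axis_approx f a b c d 0 (Suc n) (1 / Suc n)"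
        using V(3) zw B by (auto simp: E_def)
      moreover have "w \<in> rect a b c d" using zw B Q by blast
      ultimately have "norm (f w - f z - 0 * (w - z)) \<le> real (Suc n) * norm (w - z)"
        using zw(4) by (intro axis_approxD)
      then show "norm (f w - f z) \<le> real (Suc n) * norm (w - z)" by simp
    qed (use K(1) in \<open>auto simp: B_def\<close>)
    \<comment> \<open>A quarter of the radius keeps the closed square of half-side \<open>g\<close>
      inside the disc.\<close>
    define g where "g = r / 4"
    define a' b' c' d' where "a' = Re z1 - g" "b' = Re z1 + g" "c' = Im z1 - g" "d' = Im z1 + g"
    have g: "g > 0" using r by (simp add: g_def)
    have R'B: "rect a' b' c' d' \<subseteq> B"
    proof
      fix z assume "z \<in> rect a' b' c' d'"
      then have "\<bar>Re (z - z1)\<bar> + \<bar>Im (z - z1)\<bar> \<le> 2 * g"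
        by (auto simp: mem_rect a'_b'_c'_d'_def abs_le_iff)
      then have "norm (z - z1) \<le> 2 * g" using cmod_le[of "z - z1"] by linarith
      then show "z \<in> B" using r by (auto simp: B_def g_def dist_norm norm_minus_commute)
    qed
    define Q' where "Q' = box (Complex a' c') (Complex b' d')"
    have "f holomorphic_on Q'"
      unfolding Q'_def
    proof (rule holomorphic_on_box_rect_integral)
      show "continuous_on (rect a' b' c' d') f" using cont R'B continuous_on_subset by blast
      fix x y assume "a' \<le> x" "x \<le> b'" "c' \<le> y" "y \<le> d'"
      then have "rect a' x c' y \<subseteq> rect a' b' c' d'" by (auto simp: mem_rect)
      then have "rect a' x c' y \<subseteq> B" using R'B by blast
      then show "rect_integral f a' x c' y = 0"
        using \<open>a' \<le> x\<close> \<open>c' \<le> y\<close> KR RU deriv by (intro rect_integral_eq_0_axis_deriv) blast+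
    qed (use g in \<open>auto simp: a'_b'_c'_d'_def\<close>)
    moreover have "Q' \<subseteq> U"
      using R'B B Q RU box_subset_cbox[of "Complex a' c'" "Complex b' d'"]
      by (auto simp: Q'_def rect_def)
    moreover have "z1 \<in> Q'"
      using g by (auto simp: Q'_def in_box_complex_iff a'_b'_c'_d'_def)
    moreover have "open Q'" by (simp add: Q'_def open_box)
    ultimately have "z1 \<in> W" by (auto simp: W_def \<V>_def)
    then show False using z1 by blast
  qed
  then show ?thesis using W(2) holomorphic_on_subset by blast
qed

section \<open>Components of the product and Taylor extensions\<close>

definition has_dir_deriv ::
  "((nat \<Rightarrow> complex) \<Rightarrow> complex) \<Rightarrow> (nat \<Rightarrow> complex) \<Rightarrow> (nat \<Rightarrow> complex) \<Rightarrow> complex \<Rightarrow> bool" where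
  "has_dir_deriv f h z L \<longleftrightarrow>
     ((\<lambda>\<epsilon>::real. (f (vadd_rscale z \<epsilon> h) - f z) / of_real \<epsilon>) \<longlongrightarrow> L) (at_right 0)"

lemma vadd_rscale_0 [simp]: "vadd_rscale z 0 h = z"
  by (simp add: vadd_rscale_def)

lemma tendsto_coordinatewise:
  fixes f :: "'a \<Rightarrow> 'i \<Rightarrow> 'b::topological_space"
  shows "(f \<longlongrightarrow> l) F \<longleftrightarrow> (\<forall>i. ((\<lambda>x. f x i) \<longlongrightarrow> l i) F)"
proof -
  have "(f \<longlongrightarrow> l) F \<longleftrightarrow> limitin (product_topology (\<lambda>_. euclidean) UNIV) f l F"
    by (simp add: euclidean_product_topology)
  then show ?thesis by (simp add: limitin_componentwise)
qed

text \<open>Limits in the product topology are coordinatewise, which reduces the Gateaux derivative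
  to scalar directional derivatives.\<close>

lemma gateaux_deriv_on_iff:
  "gateaux_deriv_on n m Ups uu E \<Omega> \<Phi> D \<longleftrightarrow>
    (\<forall>\<zeta>\<in>\<Omega>. D \<zeta> \<in> carrierA n \<and>
      (\<forall>h\<in>E. \<forall>p. has_dir_deriv (\<lambda>z. \<Phi> z p) h \<zeta> (amult n m Ups uu h (D \<zeta>) p)))"
  by (simp add: gateaux_deriv_on_def has_dir_deriv_def tendsto_coordinatewise)

text \<open>Dividing the remainder by a real \<open>\<epsilon>\<close> or by its absolute value
  gives the same norm. The calculus rules for vector derivatives thereby become available for
  \<open>has_dir_deriv\<close>.\<close>

lemma quotient_tendsto_iff_has_vector_derivative:
  fixes g :: "real \<Rightarrow> complex"
  shows "((\<lambda>\<epsilon>. (g \<epsilon> - g 0) / of_real \<epsilon>) \<longlongrightarrow> L) (at 0 within S)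
    \<longleftrightarrow> (g has_vector_derivative L) (at 0 within S)"
proof -
  have "((\<lambda>\<epsilon>. (g \<epsilon> - g 0) / of_real \<epsilon>) \<longlongrightarrow> L) (at 0 within S)
    \<longleftrightarrow> ((\<lambda>\<epsilon>. (g \<epsilon> - g 0) / of_real \<epsilon> - L) \<longlongrightarrow> 0) (at 0 within S)"
    by (rule Lim_null)
  also have "\<dots> \<longleftrightarrow> ((\<lambda>\<epsilon>. norm ((g \<epsilon> - g 0) / of_real \<epsilon> - L)) \<longlongrightarrow> 0) (at 0 within S)"
    by (rule tendsto_norm_zero_iff[symmetric])
  also have "\<dots> \<longleftrightarrow> ((\<lambda>\<epsilon>. norm ((1 / norm (\<epsilon> - 0)) *\<^sub>R (g \<epsilon> - (g 0 + (\<epsilon> - 0) *\<^sub>R L)))) \<longlongrightarrow> 0) (at 0 within S)"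
  proof (rule filterlim_cong[OF refl refl])
    have "norm ((g \<epsilon> - g 0) / of_real \<epsilon> - L) = norm ((1 / norm (\<epsilon> - 0)) *\<^sub>R (g \<epsilon> - (g 0 + (\<epsilon> - 0) *\<^sub>R L)))"
      if "\<epsilon> \<noteq> 0" for \<epsilon> :: real
    proof -
      have "(g \<epsilon> - g 0) / of_real \<epsilon> - L = (g \<epsilon> - (g 0 + \<epsilon> *\<^sub>R L)) / of_real \<epsilon>"
        using that by (simp add: field_simps scaleR_conv_of_real)
      then show ?thesis by (simp add: norm_divide)
    qed
    then show "\<forall>\<^sub>F \<epsilon> in at 0 within S. norm ((g \<epsilon> - g 0) / of_real \<epsilon> - L)
      = norm ((1 / norm (\<epsilon> - 0)) *\<^sub>R (g \<epsilon> - (g 0 + (\<epsilon> - 0) *\<^sub>R L)))"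
      by (auto simp: eventually_at_filter)
  qed
  also have "\<dots> \<longleftrightarrow> (g has_vector_derivative L) (at 0 within S)"
    unfolding has_vector_derivative_def has_derivative_within tendsto_norm_zero_iff
    by (simp add: bounded_linear_scaleR_left)
  finally show ?thesis .
qed

lemma has_dir_deriv_iff:
  "has_dir_deriv f h z L \<longleftrightarrow>
    ((\<lambda>\<epsilon>. f (vadd_rscale z \<epsilon> h)) has_vector_derivative L) (at_right 0)"
  using quotient_tendsto_iff_has_vector_derivative[of "\<lambda>\<epsilon>. f (vadd_rscale z \<epsilon> h)" L "{0<..}"]
  by (simp add: has_dir_deriv_def)

lemma has_dir_deriv_unique:
  "\<lbrakk>has_dir_deriv f h z L; has_dir_deriv f h z L'\<rbrakk> \<Longrightarrow> L = L'"
  unfolding has_dir_deriv_def by (rule tendsto_unique[OF trivial_limit_at_right_real])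

lemma has_dir_deriv_transform:
  assumes "has_dir_deriv f h z L" "f z = g z"
    and "\<forall>\<^sub>F \<epsilon> in at_right 0. f (vadd_rscale z \<epsilon> h) = g (vadd_rscale z \<epsilon> h)"
  shows "has_dir_deriv g h z L"
  using assms(1) unfolding has_dir_deriv_def
  by (rule Lim_transform_eventually) (use assms(2,3) in \<open>auto elim: eventually_mono\<close>)

lemma has_dir_deriv_const: "has_dir_deriv (\<lambda>_. c) h z 0"
  by (simp add: has_dir_deriv_def)

lemma has_dir_deriv_coord: "has_dir_deriv (\<lambda>z. z p) h z (h p)"
  unfolding has_dir_deriv_def vadd_rscale_def
  by (rule tendsto_eventually) (auto simp: eventually_at_filter)

lemma has_dir_deriv_add:
  "\<lbrakk>has_dir_deriv f h z a; has_dir_deriv g h z b\<rbrakk> \<Longrightarrow> has_dir_deriv (\<lambda>z. f z + g z) h z (a + b)"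
  unfolding has_dir_deriv_iff by (rule has_vector_derivative_add)

lemma has_dir_deriv_diff:
  "\<lbrakk>has_dir_deriv f h z a; has_dir_deriv g h z b\<rbrakk> \<Longrightarrow> has_dir_deriv (\<lambda>z. f z - g z) h z (a - b)"
  unfolding has_dir_deriv_iff by (rule has_vector_derivative_diff)

lemma has_dir_deriv_sum:
  "(\<And>i. i \<in> I \<Longrightarrow> has_dir_deriv (f i) h z (a i)) \<Longrightarrow>
    has_dir_deriv (\<lambda>z. \<Sum>i\<in>I. f i z) h z (\<Sum>i\<in>I. a i)"
  unfolding has_dir_deriv_iff by (rule has_vector_derivative_sum)

lemma has_dir_deriv_mult:
  assumes "has_dir_deriv f h z a" "has_dir_deriv g h z b"
  shows "has_dir_deriv (\<lambda>z. f z * g z) h z (a * g z + f z * b)"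
  using has_vector_derivative_mult[OF assms[unfolded has_dir_deriv_iff]]
  by (simp add: has_dir_deriv_iff add.commute)

lemma has_dir_deriv_chain:
  assumes "has_dir_deriv f h z a" "(F has_field_derivative F') (at (f z))"
  shows "has_dir_deriv (\<lambda>z. F (f z)) h z (a * F')"
  using field_vector_diff_chain_within[OF assms(1)[unfolded has_dir_deriv_iff], of F F']
    assms(2) has_field_derivative_at_within
  by (auto simp: has_dir_deriv_iff o_def)

section \<open>The multiplication in coordinates\<close>

text \<open>The multiplication table is built into \<open>amult\<close>; commutativity and
  associativity are conditions on the structure constants \<open>Ups\<close> and
  \<open>uu\<close>.\<close>

locale commutative_algebra_A =
  fixes n m :: nat and Ups :: "nat \<Rightarrow> nat \<Rightarrow> nat \<Rightarrow> complex" and uu :: "nat \<Rightarrow> nat"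
  assumes mn: "1 \<le> m" "m \<le> n"
    and uu: "\<forall>s\<in>{m+1..n}. uu s \<in> {1..m}"
    and comm: "\<forall>a\<in>carrierA n. \<forall>b\<in>carrierA n. amult n m Ups uu a b = amult n m Ups uu b a"
    and assoc: "\<forall>a\<in>carrierA n. \<forall>b\<in>carrierA n. \<forall>c\<in>carrierA n.
        amult n m Ups uu (amult n m Ups uu a b) c = amult n m Ups uu a (amult n m Ups uu b c)"
begin

abbreviation mul :: "(nat \<Rightarrow> complex) \<Rightarrow> (nat \<Rightarrow> complex) \<Rightarrow> nat \<Rightarrow> complex" where
  "mul \<equiv> amult n m Ups uu"

text \<open>The index \<open>u\<close> of the idempotent with
  \<open>I\<^sub>u I\<^sub>r = I\<^sub>r\<close>.\<close>

definition idem_index :: "nat \<Rightarrow> nat" where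
  "idem_index r = (if r \<le> m then r else uu r)"

lemma idem_index: "r \<in> {1..n} \<Longrightarrow> idem_index r \<in> {1..m}"
  using uu by (auto simp: idem_index_def)

text \<open>A product involving a basis element of index above \<open>m\<close> has coordinates only
  above \<open>m\<close>; hence each \<open>f\<^sub>u\<close> is multiplicative.\<close>

lemma mul_low:
  assumes "q \<in> {1..m}"
  shows "mul a b q = a q * b q"
proof -
  have "mul a b q = (\<Sum>r=1..n. \<Sum>s=1..n. if r = q then if s = q then a q * b q else 0 else 0)"
    unfolding amult_def using assms
    by (intro sum.cong refl) (auto simp: bprod_def basisI_def)
  also have "\<dots> = (\<Sum>r=1..n. if r = q then \<Sum>s=1..n. if s = q then a q * b q else 0 else 0)"
    by (intro sum.cong refl) auto
  also have "\<dots> = a q * b q" using assms mn by simp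
  finally show ?thesis .
qed

text \<open>Coordinate \<open>q\<close> arises from the idempotent acting on
  \<open>I\<^sub>q\<close> and from products of nilpotent basis elements of smaller index. This
  triangular shape drives all later inductions.\<close>

lemma mul_high:
  assumes "q \<in> {m+1..n}"
  shows "mul a b q = a (uu q) * b q + a q * b (uu q) +
    (\<Sum>r=1..n. \<Sum>s=1..n. if m < r \<and> m < s \<and> r < q \<and> s < q then a r * b s * Ups s r q else 0)"
proof -
  have u: "uu q \<in> {1..m}" using uu assms by blast
  have delta: "(\<Sum>r=1..n. \<Sum>s=1..n. if r = c \<and> s = d then a c * b d else 0) = a c * b d"
    if "c \<in> {1..n}" "d \<in> {1..n}" for c d
  proof -
    have "(\<Sum>r=1..n. \<Sum>s=1..n. if r = c \<and> s = d then a c * b d else 0)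
      = (\<Sum>r=1..n. if r = c then \<Sum>s=1..n. if s = d then a c * b d else 0 else 0)"
      by (intro sum.cong refl) auto
    then show ?thesis using that by simp
  qed
  have "mul a b q = (\<Sum>r=1..n. \<Sum>s=1..n.
      (if r = uu q \<and> s = q then a (uu q) * b q else 0) + (if r = q \<and> s = uu q then a q * b (uu q) else 0)
      + (if m < r \<and> m < s \<and> r < q \<and> s < q then a r * b s * Ups s r q else 0))"
    unfolding amult_def using assms u
    by (intro sum.cong refl) (auto simp: bprod_def basisI_def)
  also have "\<dots> = a (uu q) * b q + a q * b (uu q) +
    (\<Sum>r=1..n. \<Sum>s=1..n. if m < r \<and> m < s \<and> r < q \<and> s < q then a r * b s * Ups s r q else 0)"
    using delta[of "uu q" q] delta[of q "uu q"] assms u mn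
    by (simp add: sum.distrib)
  finally show ?thesis .
qed

lemma mul_carrier: "mul a b \<in> carrierA n"
proof -
  have "bprod n m Ups uu r s i = 0" if "i \<notin> {1..n}" "r \<in> {1..n}" "s \<in> {1..n}" for r s i
    using that by (auto simp: bprod_def basisI_def)
  then show ?thesis by (simp add: carrierA_def amult_def)
qed

lemma carrierA_0: "x \<in> carrierA n \<Longrightarrow> i \<notin> {1..n} \<Longrightarrow> x i = 0"
  by (simp add: carrierA_def)

lemma basisI_carrier: "r \<in> {1..n} \<Longrightarrow> basisI r \<in> carrierA n"
  by (auto simp: carrierA_def basisI_def)

lemma eq_carrierI:
  assumes "x \<in> carrierA n" "y \<in> carrierA n"
    "\<And>q. q \<in> {1..m} \<Longrightarrow> x q = y q" "\<And>q. q \<in> {m+1..n} \<Longrightarrow> x q = y q"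
  shows "x = y"
proof
  fix q show "x q = y q"
    using assms carrierA_0[of x q] carrierA_0[of y q]
    by (cases "q \<in> {1..n}"; cases "q \<le> m") auto
qed

lemma mul_aunit: "x \<in> carrierA n \<Longrightarrow> mul (aunit m) x = x"
proof (rule eq_carrierI)
  fix q assume q: "q \<in> {m+1..n}"
  then have "uu q \<in> {1..m}" using uu by blast
  then have "aunit m (uu q) = 1" by (simp add: aunit_def)
  moreover have "(\<Sum>r=1..n. \<Sum>s=1..n. if m < r \<and> m < s \<and> r < q \<and> s < q
      then aunit m r * x s * Ups s r q else 0) = 0"
    by (intro sum.neutral ballI) (auto simp: aunit_def)
  moreover have "aunit m q = 0" using q by (simp add: aunit_def)
  ultimately show "mul (aunit m) x q = x q"
    using mul_high[OF q] by simp
qed (auto simp: mul_carrier mul_low aunit_def)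

text \<open>Multiplication by an idempotent projects onto the coordinates it governs.\<close>

lemma mul_basisI:
  assumes "u \<in> {1..m}" "q \<in> {1..n}"
  shows "mul (basisI u) x q = (if idem_index q = u then x q else 0)"
proof (cases "q \<le> m")
  case True
  then show ?thesis using assms by (simp add: mul_low basisI_def idem_index_def)
next
  case False
  then have q: "q \<in> {m+1..n}" using assms by auto
  have "(\<Sum>r=1..n. \<Sum>s=1..n. if m < r \<and> m < s \<and> r < q \<and> s < q
      then basisI u r * x s * Ups s r q else 0) = 0"
    using assms by (intro sum.neutral ballI) (auto simp: basisI_def)
  moreover have "basisI u q = 0" "basisI u (uu q) = (if idem_index q = u then 1 else 0)"
    using assms False by (auto simp: basisI_def idem_index_def)
  ultimately show ?thesis using mul_high[OF q] by simp
qed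

text \<open>The remaining terms of \<open>mul_high\<close> involve coordinates of \<open>x\<close>
  below \<open>r\<close>, including \<open>uu r\<close>, which is at most \<open>m\<close>.\<close>

lemma mul_leading:
  assumes "\<And>p. p < r \<Longrightarrow> x p = 0" "r \<in> {1..n}"
  shows "mul h x r = h (idem_index r) * x r"
proof (cases "r \<le> m")
  case True
  then show ?thesis using assms by (simp add: mul_low idem_index_def)
next
  case False
  then have q: "r \<in> {m+1..n}" using assms by auto
  then have "uu r \<in> {1..m}" using uu by blast
  then have "x (uu r) = 0" using False assms(1) by auto
  moreover have "(\<Sum>p=1..n. \<Sum>s=1..n. if m < p \<and> m < s \<and> p < r \<and> s < r
      then h p * x s * Ups s p r else 0) = 0"
    using assms(1) by (intro sum.neutral ballI) auto
  ultimately show ?thesis using q False by (simp add: mul_high idem_index_def)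
qed

text \<open>At index \<open>j\<close> the product is \<open>a (idem_index j) * x j\<close>. This is
  zero if \<open>I\<^sub>u\<close> governs \<open>j\<close>, as \<open>a u = 0\<close>; otherwise
  \<open>x j = 0\<close>, since \<open>x\<close> is fixed by \<open>I\<^sub>u\<close>. So
  multiplication by \<open>a\<close> pushes the leading index up by one.\<close>

lemma mul_nilpotent_step:
  assumes x: "mul (basisI u) x = x" "\<And>p. p < j \<Longrightarrow> x p = 0" and u: "u \<in> {1..m}" and a: "a u = 0"
    and p: "p < Suc j"
  shows "mul a x p = 0"
proof (cases "p \<in> {1..n}")
  case True
  have "mul a x p = a (idem_index p) * x p"
    using x(2) p by (intro mul_leading True) auto
  moreover have "x p = 0" if "idem_index p \<noteq> u"
    using mul_basisI[OF u True, of x] x(1) that by simp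
  ultimately show ?thesis using a by auto
next
  case False
  then show ?thesis using mul_carrier carrierA_0 by blast
qed

lemma mul_left_commute:
  assumes "a \<in> carrierA n" "b \<in> carrierA n" "c \<in> carrierA n"
  shows "mul a (mul b c) = mul b (mul a c)"
  using assms assoc comm by metis

lemma mul_sum_right: "mul a (\<lambda>p. \<Sum>k\<in>I. f k * x k p) p = (\<Sum>k\<in>I. f k * mul a (x k) p)"
proof -
  have "mul a (\<lambda>p. \<Sum>k\<in>I. f k * x k p) p
    = (\<Sum>r=1..n. \<Sum>s=1..n. \<Sum>k\<in>I. f k * (a r * x k s * bprod n m Ups uu r s p))"
    unfolding amult_def sum_distrib_left sum_distrib_right
    by (intro sum.cong refl) (simp add: mult_ac)
  also have "\<dots> = (\<Sum>r=1..n. \<Sum>k\<in>I. \<Sum>s=1..n. f k * (a r * x k s * bprod n m Ups uu r s p))"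
    by (intro sum.cong refl sum.swap)
  also have "\<dots> = (\<Sum>k\<in>I. \<Sum>r=1..n. \<Sum>s=1..n. f k * (a r * x k s * bprod n m Ups uu r s p))"
    by (rule sum.swap)
  also have "\<dots> = (\<Sum>k\<in>I. f k * mul a (x k) p)"
    unfolding amult_def sum_distrib_left ..
  finally show ?thesis .
qed

lemma mul_cmult_right: "mul a (\<lambda>p. c * x p) p = c * mul a x p"
  using mul_sum_right[where I = "{()}" and f = "\<lambda>_. c" and x = "\<lambda>_. x"] by simp

lemma mul_add_right: "mul a (\<lambda>p. x p + y p) p = mul a x p + mul a y p"
  unfolding amult_def by (simp add: algebra_simps sum.distrib)

lemma mul_diff_right: "mul a (\<lambda>p. x p - y p) p = mul a x p - mul a y p"
  unfolding amult_def by (simp add: algebra_simps sum_subtractf)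

lemma mul_diff_cmult_left: "mul (\<lambda>p. a p - c * b p) x p = mul a x p - c * mul b x p"
  unfolding amult_def sum_distrib_left
  by (simp add: algebra_simps sum_subtractf flip: sum_distrib_left)

lemma has_dir_deriv_mul:
  assumes "\<And>p. has_dir_deriv (\<lambda>z. A z p) h z (A' p)" "\<And>p. has_dir_deriv (\<lambda>z. B z p) h z (B' p)"
  shows "has_dir_deriv (\<lambda>z. mul (A z) (B z) p) h z (mul A' (B z) p + mul (A z) B' p)"
proof -
  have "has_dir_deriv (\<lambda>z. A z r * B z s * bprod n m Ups uu r s p) h z
      ((A' r * B z s + A z r * B' s) * bprod n m Ups uu r s p)" for r s
    using has_dir_deriv_mult[OF has_dir_deriv_mult[OF assms(1)[of r] assms(2)[of s]] has_dir_deriv_const]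
    by simp
  then have "has_dir_deriv (\<lambda>z. mul (A z) (B z) p) h z
      (\<Sum>r=1..n. \<Sum>s=1..n. (A' r * B z s + A z r * B' s) * bprod n m Ups uu r s p)"
    unfolding amult_def by (intro has_dir_deriv_sum)
  then show ?thesis unfolding amult_def by (simp add: distrib_right sum.distrib)
qed

section \<open>Taylor extensions of holomorphic functions\<close>

definition nil_part :: "nat \<Rightarrow> (nat \<Rightarrow> complex) \<Rightarrow> nat \<Rightarrow> complex" where
  "nil_part u z = (\<lambda>p. z p - z u * aunit m p)"

text \<open>\<open>nil_power r k z\<close> is \<open>I\<^sub>r N\<^sup>k / k!\<close> with \<open>N = z - f\<^sub>u(z) 1\<close>, \<open>u = u\<^sub>r\<close>; \<open>N\<close> acts nilpotently on \<open>I\<^sub>r\<close>.\<close>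

primrec nil_power :: "nat \<Rightarrow> nat \<Rightarrow> (nat \<Rightarrow> complex) \<Rightarrow> nat \<Rightarrow> complex" where
  "nil_power r 0 z = basisI r"
| "nil_power r (Suc k) z = (\<lambda>p. 1 / of_nat (Suc k) * mul (nil_part (idem_index r) z) (nil_power r k z) p)"

text \<open>The Taylor expansion of \<open>F(z) I\<^sub>r\<close> around the scalar \<open>f\<^sub>u(z)\<close>.\<close>

definition hol_ext :: "nat \<Rightarrow> (complex \<Rightarrow> complex) \<Rightarrow> (nat \<Rightarrow> complex) \<Rightarrow> nat \<Rightarrow> complex" where
  "hol_ext r F z = (\<lambda>p. \<Sum>k\<le>n. (deriv ^^ k) F (z (idem_index r)) * nil_power r k z p)"

lemma nil_part_carrier: "z \<in> carrierA n \<Longrightarrow> nil_part u z \<in> carrierA n"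
  using mn by (auto simp: nil_part_def carrierA_def aunit_def)

lemma nil_power_carrier: "r \<in> {1..n} \<Longrightarrow> nil_power r k z \<in> carrierA n"
  by (cases k) (auto simp: basisI_carrier carrierA_def carrierA_0[OF mul_carrier] basisI_def)

lemma mul_nil_part:
  "x \<in> carrierA n \<Longrightarrow> mul (nil_part u h) x p = mul h x p - h u * x p"
  unfolding nil_part_def mul_diff_cmult_left by (simp add: mul_aunit)

text \<open>Multiplication by the nilpotent part commutes with the projection by
  \<open>I\<^sub>u\<close> and raises the leading index by one each time, starting from
  \<open>r\<close>.\<close>

lemma nil_power_props:
  assumes r: "r \<in> {1..n}" and z: "z \<in> carrierA n"
  shows "mul (basisI (idem_index r)) (nil_power r k z) = nil_power r k z
    \<and> (\<forall>p < r + k. nil_power r k z p = 0)"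
proof (induction k)
  case 0
  have "mul (basisI (idem_index r)) (basisI r) q = basisI r q" for q
    using mul_basisI[OF idem_index[OF r], of q] r
      carrierA_0[OF mul_carrier] carrierA_0[OF basisI_carrier[OF r]]
    by (cases "q \<in> {1..n}") (auto simp: basisI_def)
  then show ?case by (auto simp: basisI_def)
next
  case (Suc k)
  let ?u = "idem_index r"
  have u: "?u \<in> {1..m}" using idem_index[OF r] .
  have uc: "basisI ?u \<in> carrierA n" using u mn by (intro basisI_carrier) auto
  have nc: "nil_part ?u z \<in> carrierA n" using z by (rule nil_part_carrier)
  have "mul (basisI ?u) (nil_power r (Suc k) z) = nil_power r (Suc k) z"
    unfolding nil_power.simps fun_eq_iff mul_cmult_right
    using mul_left_commute[OF uc nc nil_power_carrier[OF r, of k z]] Suc.IH by simp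
  moreover have "mul (nil_part ?u z) (nil_power r k z) p = 0" if "p < r + Suc k" for p
    using Suc.IH u that by (intro mul_nilpotent_step[where j = "r + k"]) (auto simp: nil_part_def aunit_def)
  ultimately show ?case by simp
qed

lemma nil_power_eq_0: "\<lbrakk>r \<in> {1..n}; z \<in> carrierA n; n < r + k\<rbrakk> \<Longrightarrow> nil_power r k z = (\<lambda>_. 0)"
  using nil_power_props[of r z k] carrierA_0[OF nil_power_carrier, of r _ k z]
  by (metis atLeastAtMost_iff ext le_less_trans)

text \<open>The power rule: \<open>nil_part\<close> is linear in its argument, so differentiating
  \<open>N\<^sup>k / k!\<close> in direction \<open>h\<close> replaces one factor \<open>N\<close>
  by the nilpotent part of \<open>h\<close> and lowers the factorial.\<close>

lemma has_dir_deriv_nil_power: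
  assumes r: "r \<in> {1..n}" and z: "z \<in> carrierA n" and h: "h \<in> carrierA n"
  shows "has_dir_deriv (\<lambda>z. nil_power r k z p) h z
    (case k of 0 \<Rightarrow> 0 | Suc j \<Rightarrow> mul (nil_part (idem_index r) h) (nil_power r j z) p)"
proof (induction k arbitrary: p)
  case 0
  then show ?case by (simp add: has_dir_deriv_const)
next
  case (Suc k)
  let ?u = "idem_index r" and ?c = "1 / of_nat (Suc k) :: complex"
  define T' where "T' = (\<lambda>p. case k of 0 \<Rightarrow> 0 | Suc j \<Rightarrow> mul (nil_part ?u h) (nil_power r j z) p)"
  have dN: "has_dir_deriv (\<lambda>z. nil_part ?u z p) h z (nil_part ?u h p)" for p
    unfolding nil_part_def
    using has_dir_deriv_diff[OF has_dir_deriv_coord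
        has_dir_deriv_mult[OF has_dir_deriv_coord has_dir_deriv_const]] by simp
  have dT: "has_dir_deriv (\<lambda>z. nil_power r k z p) h z (T' p)" for p
    using Suc.IH by (simp add: T'_def)
  have "has_dir_deriv (\<lambda>z. ?c * mul (nil_part ?u z) (nil_power r k z) p) h z
      (0 * mul (nil_part ?u z) (nil_power r k z) p
        + ?c * (mul (nil_part ?u h) (nil_power r k z) p + mul (nil_part ?u z) T' p))"
    by (intro has_dir_deriv_mult has_dir_deriv_const has_dir_deriv_mul dN dT)
  \<comment> \<open>Commutativity and associativity move the nilpotent part of \<open>h\<close> to
    the front; restoring the factorial of the \<open>k\<close>-th power produces the factor
    \<open>k\<close>.\<close>
  moreover have "mul (nil_part ?u z) T' p = of_nat k * mul (nil_part ?u h) (nil_power r k z) p"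
  proof (cases k)
    case 0
    then show ?thesis by (simp add: T'_def amult_def)
  next
    case (Suc j)
    have "mul (nil_part ?u z) T' p = mul (nil_part ?u h) (mul (nil_part ?u z) (nil_power r j z)) p"
      unfolding T'_def Suc
      using mul_left_commute[OF nil_part_carrier[OF z] nil_part_carrier[OF h] nil_power_carrier[OF r]]
      by simp
    also have "mul (nil_part ?u z) (nil_power r j z) = (\<lambda>p. of_nat k * nil_power r k z p)"
      unfolding Suc by (simp add: fun_eq_iff del: of_nat_Suc)
    finally show ?thesis by (simp add: mul_cmult_right)
  qed
  moreover have "?c * (x + of_nat k * x) = x" for x :: complex
    by (simp add: field_simps flip: of_nat_Suc)
       (metis (no_types) add.commute mult.commute of_nat_Suc distrib_left mult_1)
  ultimately show ?case by simp
qed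

text \<open>Differentiating the coefficients gives \<open>h ?u\<close> times the extension of
  \<open>deriv F\<close>; differentiating the powers gives, after an index shift, the nilpotent part
  of \<open>h\<close> times the same extension. Both parts of \<open>h\<close> together give
  \<open>h\<close>.\<close>

lemma has_dir_deriv_hol_ext:
  assumes r: "r \<in> {1..n}" and z: "z \<in> carrierA n" and h: "h \<in> carrierA n"
    and F: "F holomorphic_on S" "open S" "z (idem_index r) \<in> S"
  shows "has_dir_deriv (\<lambda>z. hol_ext r F z p) h z (mul h (hol_ext r (deriv F) z) p)"
proof -
  let ?u = "idem_index r"
  define T where "T = (\<lambda>k. nil_power r k z)"
  define T' where "T' = (\<lambda>k p. case k of 0 \<Rightarrow> 0 | Suc j \<Rightarrow> mul (nil_part ?u h) (T j) p)"
  define G where "G = (\<lambda>k. (deriv ^^ k) F (z ?u))"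
  have "((deriv ^^ k) F has_field_derivative G (Suc k)) (at (z ?u))" for k
    unfolding G_def using holomorphic_derivI[OF holomorphic_higher_deriv[OF F(1,2)] F(2,3)]
    by simp
  then have "has_dir_deriv (\<lambda>z. (deriv ^^ k) F (z ?u)) h z (h ?u * G (Suc k))" for k
    by (intro has_dir_deriv_chain has_dir_deriv_coord)
  then have "has_dir_deriv (\<lambda>z. hol_ext r F z p) h z
      (\<Sum>k\<le>n. h ?u * G (Suc k) * T k p + G k * T' k p)"
    unfolding hol_ext_def T_def T'_def G_def
    by (intro has_dir_deriv_sum has_dir_deriv_mult has_dir_deriv_nil_power r z h)
  \<comment> \<open>The shift is exact: \<open>T' 0\<close> is zero, and \<open>T n\<close> vanishes
    because its leading index would be at least \<open>r + n\<close>, hence above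
    \<open>n\<close>.\<close>
  moreover have "(\<Sum>k\<le>n. G k * T' k p) = (\<Sum>k\<le>n. G (Suc k) * mul (nil_part ?u h) (T k) p)"
  proof -
    have "T n = (\<lambda>_. 0)" unfolding T_def using r z by (intro nil_power_eq_0) auto
    then have "(\<Sum>k\<le>n. G (Suc k) * mul (nil_part ?u h) (T k) p)
      = (\<Sum>k<n. G (Suc k) * T' (Suc k) p)"
      by (simp add: T'_def amult_def flip: lessThan_Suc_atMost)
    also have "\<dots> = (\<Sum>k<Suc n. G k * T' k p)"
      by (subst sum.lessThan_Suc_shift) (simp add: T'_def)
    finally show ?thesis by (simp add: lessThan_Suc_atMost)
  qed
  moreover have "mul h (hol_ext r (deriv F) z) p = (\<Sum>k\<le>n. G (Suc k) * mul h (T k) p)"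
    unfolding hol_ext_def mul_sum_right by (simp add: G_def T_def funpow_swap1)
  moreover have "mul h (T k) p = h ?u * T k p + mul (nil_part ?u h) (T k) p" for k
    using mul_nil_part[OF nil_power_carrier[OF r]] by (simp add: T_def)
  ultimately show ?thesis by (simp add: sum.distrib distrib_left mult_ac)
qed

lemma hol_ext_carrier: "r \<in> {1..n} \<Longrightarrow> hol_ext r F z \<in> carrierA n"
  using nil_power_carrier by (simp add: carrierA_def hol_ext_def)

lemma hol_ext_below:
  assumes "r \<in> {1..n}" "z \<in> carrierA n" "p < r"
  shows "hol_ext r F z p = 0"
  unfolding hol_ext_def using nil_power_props[OF assms(1,2)] assms(3)
  by (intro sum.neutral) auto

text \<open>The powers with \<open>k\<close> at least 1 start above \<open>r\<close>, so only the
  term \<open>k = 0\<close> remains. With \<open>hol_ext_below\<close> this allows the coordinate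
  \<open>r\<close> to be cleared without disturbing the earlier ones.\<close>

lemma hol_ext_leading:
  assumes "r \<in> {1..n}" "z \<in> carrierA n"
  shows "hol_ext r F z r = F (z (idem_index r))"
proof -
  have "(\<Sum>k\<in>{..n} - {0}. (deriv ^^ k) F (z (idem_index r)) * nil_power r k z r) = 0"
    using nil_power_props[OF assms] by (intro sum.neutral) auto
  then show ?thesis
    unfolding hol_ext_def by (subst sum.remove[of _ 0]) (auto simp: basisI_def)
qed

lemma continuous_on_coord: "continuous_on A (\<lambda>z. z q)"
  for A :: "('i \<Rightarrow> 'b::topological_space) set"
  by (rule continuous_on_subset[OF continuous_on_product_coordinates subset_UNIV])

lemma continuous_on_nil_power: "continuous_on A (\<lambda>z. nil_power r k z p)"
proof (induction k arbitrary: p)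
  case (Suc k)
  then show ?case
    unfolding nil_power.simps amult_def nil_part_def
    by (intro continuous_intros continuous_on_coord)
qed simp

lemma continuous_on_hol_ext:
  assumes F: "F holomorphic_on S" "open S" and A: "\<And>z. z \<in> A \<Longrightarrow> z (idem_index r) \<in> S"
  shows "continuous_on A (hol_ext r F)"
proof (rule continuous_on_coordinatewise_then_product)
  fix p
  have "continuous_on S ((deriv ^^ k) F)" for k
    using F by (intro holomorphic_on_imp_continuous_on holomorphic_higher_deriv)
  then have "continuous_on A (\<lambda>z. (deriv ^^ k) F (z (idem_index r)))" for k
    by (rule continuous_on_compose2[OF _ continuous_on_coord]) (use A in auto)
  then show "continuous_on A (\<lambda>z. hol_ext r F z p)"
    unfolding hol_ext_def by (intro continuous_intros continuous_on_nil_power)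
qed

end

section \<open>Local structure of monogenic functions\<close>

text \<open>The right-hand quotient in direction \<open>-h\<close> is, up to sign, the left-hand
  quotient in direction \<open>h\<close>.\<close>

lemma has_dir_deriv_two_sided:
  assumes "has_dir_deriv f h z L" "has_dir_deriv f (\<lambda>p. - h p) z (- L)"
  shows "((\<lambda>\<epsilon>::real. (f (vadd_rscale z \<epsilon> h) - f z) / of_real \<epsilon>) \<longlongrightarrow> L) (at 0)"
proof -
  have "((\<lambda>\<epsilon>::real. - ((f (vadd_rscale z \<epsilon> (\<lambda>p. - h p)) - f z) / of_real \<epsilon>)) \<longlongrightarrow> - (- L)) (at_right 0)"
    using assms(2) unfolding has_dir_deriv_def by (rule tendsto_minus)
  moreover have "vadd_rscale z \<epsilon> (\<lambda>p. - h p) = vadd_rscale z (- \<epsilon>) h" for \<epsilon>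
    by (simp add: vadd_rscale_def)
  ultimately have "((\<lambda>\<epsilon>::real. (f (vadd_rscale z \<epsilon> h) - f z) / of_real \<epsilon>) \<longlongrightarrow> L) (at_left 0)"
    by (simp add: filterlim_at_left_to_right[of _ _ 0])
  then show ?thesis
    using assms(1) unfolding has_dir_deriv_def filterlim_at_split by simp
qed

lemma vadd_rscale_vadd_rscale: "vadd_rscale (vadd_rscale z s h) t h = vadd_rscale z (s + t) h"
  by (simp add: vadd_rscale_def algebra_simps)

text \<open>The real span enters through these properties: it is a real subspace, contains the unit,
  and is mapped onto the complex plane by each \<open>f\<^sub>u\<close>.\<close>

locale monogenic_setting = commutative_algebra_A +
  fixes E :: "(nat \<Rightarrow> complex) set"
  assumes E_sub: "E \<subseteq> carrierA n"
    and E_lin: "\<And>z h t. \<lbrakk>z \<in> E; h \<in> E\<rbrakk> \<Longrightarrow> vadd_rscale z t h \<in> E"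
    and E_unit: "aunit m \<in> E"
    and E_surj: "\<And>u. u \<in> {1..m} \<Longrightarrow> (\<lambda>x. x u) ` E = UNIV"
begin

text \<open>A relative polydisc. Finitely many coordinates determine a point of the carrier, so
  these sets form a neighbourhood base in \<open>E\<close>; they are also convex.\<close>

definition nbhd :: "(nat \<Rightarrow> complex) \<Rightarrow> real \<Rightarrow> (nat \<Rightarrow> complex) set" where
  "nbhd \<zeta> \<rho> = {z \<in> E. \<forall>p\<in>{1..n}. norm (z p - \<zeta> p) < \<rho>}"

abbreviation gateaux where
  "gateaux \<equiv> gateaux_deriv_on n m Ups uu E"

lemma E_0: "(\<lambda>_. 0) \<in> E"
  using E_lin[OF E_unit E_unit, of "-1"] by (simp add: vadd_rscale_def)

lemma E_diff: "\<lbrakk>z \<in> E; y \<in> E\<rbrakk> \<Longrightarrow> (\<lambda>p. z p - y p) \<in> E"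
  using E_lin[of z y "-1"] by (simp add: vadd_rscale_def)

lemma E_uminus: "h \<in> E \<Longrightarrow> (\<lambda>p. - h p) \<in> E"
  using E_diff[OF E_0] by simp

lemma nbhd_mono: "\<rho> \<le> \<rho>' \<Longrightarrow> nbhd \<zeta> \<rho> \<subseteq> nbhd \<zeta> \<rho>'"
  by (force simp: nbhd_def)

lemma nbhd_center: "\<lbrakk>\<zeta> \<in> E; \<rho> > 0\<rbrakk> \<Longrightarrow> \<zeta> \<in> nbhd \<zeta> \<rho>"
  by (simp add: nbhd_def)

lemma nbhd_sub_E: "nbhd \<zeta> \<rho> \<subseteq> E"
  by (auto simp: nbhd_def)

lemma eventually_in_nbhd:
  assumes "z \<in> nbhd \<zeta> \<rho>" "h \<in> E"
  shows "\<forall>\<^sub>F \<epsilon> in at 0 within S. vadd_rscale z \<epsilon> h \<in> nbhd \<zeta> \<rho>"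
proof -
  have "\<forall>\<^sub>F \<epsilon> in at 0 within S. norm (vadd_rscale z \<epsilon> h p - \<zeta> p) < \<rho>" if "p \<in> {1..n}" for p
  proof (rule order_tendstoD(2))
    show "((\<lambda>\<epsilon>. norm (vadd_rscale z \<epsilon> h p - \<zeta> p)) \<longlongrightarrow> norm (z p + of_real 0 * h p - \<zeta> p)) (at 0 within S)"
      unfolding vadd_rscale_def by (intro tendsto_intros)
    show "norm (z p + of_real 0 * h p - \<zeta> p) < \<rho>" using assms(1) that by (simp add: nbhd_def)
  qed
  then have "\<forall>\<^sub>F \<epsilon> in at 0 within S. \<forall>p\<in>{1..n}. norm (vadd_rscale z \<epsilon> h p - \<zeta> p) < \<rho>"
    by (intro eventually_ball_finite) auto
  then show ?thesis
    by (rule eventually_mono) (use assms E_lin nbhd_sub_E in \<open>auto simp: nbhd_def\<close>)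
qed

lemma nbhd_convex:
  assumes "z \<in> nbhd \<zeta> \<rho>" "vadd_rscale z 1 h \<in> nbhd \<zeta> \<rho>" "h \<in> E" "0 \<le> t" "t \<le> 1"
  shows "vadd_rscale z t h \<in> nbhd \<zeta> \<rho>"
proof -
  have "norm (vadd_rscale z t h p - \<zeta> p) < \<rho>" if "p \<in> {1..n}" for p
  proof -
    have *: "z p \<in> ball (\<zeta> p) \<rho>" "z p + h p \<in> ball (\<zeta> p) \<rho>"
      using assms(1,2) that by (auto simp: nbhd_def vadd_rscale_def dist_norm norm_minus_commute)
    have "(1 - t) *\<^sub>R z p + t *\<^sub>R (z p + h p) \<in> ball (\<zeta> p) \<rho>"
      using assms(4,5) by (intro convexD[OF convex_ball *]) auto
    then show ?thesis
      by (simp add: vadd_rscale_def dist_norm norm_minus_commute scaleR_conv_of_real algebra_simps)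
  qed
  then show ?thesis using assms(1,3) E_lin by (auto simp: nbhd_def)
qed

lemma nbhd_open: "\<exists>O'. open O' \<and> nbhd \<zeta> \<rho> = E \<inter> O'"
proof (intro exI conjI)
  show "open (\<Inter>p\<in>{1..n}. {z::nat \<Rightarrow> complex. norm (z p - \<zeta> p) < \<rho>})"
    by (intro open_INT open_Collect_less continuous_intros continuous_on_coord ballI) auto
  show "nbhd \<zeta> \<rho> = E \<inter> (\<Inter>p\<in>{1..n}. {z. norm (z p - \<zeta> p) < \<rho>})"
    by (auto simp: nbhd_def)
qed

lemma openin_contains_nbhd:
  assumes "openin (top_of_set E) \<Omega>" "\<zeta> \<in> \<Omega>"
  shows "\<exists>\<rho>>0. nbhd \<zeta> \<rho> \<subseteq> \<Omega>"
proof -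
  obtain T where T: "open T" "\<Omega> = E \<inter> T" using assms(1) by (auto simp: openin_open)
  then have "openin (product_topology (\<lambda>_::nat. euclidean :: complex topology) UNIV) T"
    by (simp add: euclidean_product_topology)
  from product_topology_open_contains_basis[OF this, of \<zeta>] obtain X where
    X: "\<zeta> \<in> (\<Pi>\<^sub>E i\<in>UNIV. X i)" "\<And>i. open (X i)" "(\<Pi>\<^sub>E i\<in>UNIV. X i) \<subseteq> T"
    using assms(2) T(2) by auto
  have "\<exists>\<rho>>0. ball (\<zeta> p) \<rho> \<subseteq> X p" for p
    using X(1,2) open_contains_ball by (metis PiE_mem UNIV_I)
  then obtain r where r: "\<And>p. r p > 0" "\<And>p. ball (\<zeta> p) (r p) \<subseteq> X p" by metis
  \<comment> \<open>\<open>Suc n\<close> makes the range of indices include \<open>n\<close>;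
    coordinates outside \<open>{1..n}\<close> are zero for both points.\<close>
  obtain \<rho> where \<rho>: "\<rho> > 0" "\<forall>i<Suc n. \<rho> \<le> r i"
    using ex_common_lower_bound[of "Suc n" r] r(1) by blast
  have "nbhd \<zeta> \<rho> \<subseteq> \<Omega>"
  proof
    fix z assume z: "z \<in> nbhd \<zeta> \<rho>"
    have "z p \<in> X p" for p
    proof (cases "p \<in> {1..n}")
      case True
      then have "norm (z p - \<zeta> p) < \<rho>" "\<rho> \<le> r p" using z \<rho>(2) by (auto simp: nbhd_def)
      then have "z p \<in> ball (\<zeta> p) (r p)" by (simp add: dist_norm norm_minus_commute)
      then show ?thesis using r(2) by blast
    next
      case False
      have "z \<in> carrierA n" "\<zeta> \<in> carrierA n" using z assms(2) T(2) E_sub by (auto simp: nbhd_def)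
      then have "z p = \<zeta> p" using carrierA_0[of z p] carrierA_0[of \<zeta> p] False by simp
      then show ?thesis using X(1) by auto
    qed
    then have "z \<in> T" using X(3) by auto
    then show "z \<in> \<Omega>" using z T(2) by (auto simp: nbhd_def)
  qed
  then show ?thesis using \<rho>(1) by blast
qed

lemma gateaux_subset: "\<lbrakk>gateaux \<Omega> \<Phi> D; \<Omega>' \<subseteq> \<Omega>\<rbrakk> \<Longrightarrow> gateaux \<Omega>' \<Phi> D"
  by (auto simp: gateaux_deriv_on_iff)

lemma gateaux_add:
  assumes "gateaux \<Omega> \<Phi> D" "gateaux \<Omega> \<Psi> D'"
  shows "gateaux \<Omega> (\<lambda>z p. \<Phi> z p + \<Psi> z p) (\<lambda>z p. D z p + D' z p)"
  using assms unfolding gateaux_deriv_on_iff mul_add_right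
  by (auto simp: carrierA_def intro: has_dir_deriv_add)

lemma gateaux_diff:
  assumes "gateaux \<Omega> \<Phi> D" "gateaux \<Omega> \<Psi> D'"
  shows "gateaux \<Omega> (\<lambda>z p. \<Phi> z p - \<Psi> z p) (\<lambda>z p. D z p - D' z p)"
  using assms unfolding gateaux_deriv_on_iff mul_diff_right
  by (auto simp: carrierA_def intro: has_dir_deriv_diff)

lemma gateaux_hol_ext:
  assumes "r \<in> {1..n}" "F holomorphic_on S" "open S"
    and "V \<subseteq> E" "\<And>z. z \<in> V \<Longrightarrow> z (idem_index r) \<in> S"
  shows "gateaux V (hol_ext r F) (hol_ext r (deriv F))"
  unfolding gateaux_deriv_on_iff
  using assms E_sub by (auto intro!: hol_ext_carrier has_dir_deriv_hol_ext)

text \<open>The unit is an admissible direction and acts as identity on the derivative, so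
  \<open>D\<close> is itself a directional derivative of \<open>\<Phi>\<close>.\<close>

lemma gateaux_unit:
  assumes "gateaux V \<Phi> D" "z \<in> V"
  shows "has_dir_deriv (\<lambda>z. \<Phi> z p) (aunit m) z (D z p)"
  using assms E_unit mul_aunit[of "D z"] unfolding gateaux_deriv_on_iff by metis

lemma gateaux_below_0:
  assumes "gateaux (nbhd \<zeta> \<rho>) \<Phi> D" "\<And>z. z \<in> nbhd \<zeta> \<rho> \<Longrightarrow> \<Phi> z p = 0" "z \<in> nbhd \<zeta> \<rho>"
  shows "D z p = 0"
proof -
  have "has_dir_deriv (\<lambda>_. 0) (aunit m) z (D z p)"
    using gateaux_unit[OF assms(1,3)]
    by (rule has_dir_deriv_transform)
       (use assms(2,3) eventually_mono[OF eventually_in_nbhd[OF assms(3) E_unit]] in auto)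
  then show ?thesis using has_dir_deriv_const has_dir_deriv_unique by blast
qed

section \<open>Local structure and the second derivative\<close>

text \<open>Directions with \<open>h u = 0\<close> have zero derivative, so \<open>\<phi>\<close> is
  constant on the convex fibres of the coordinate \<open>u\<close>. Restricted to a real plane that
  is a section of this coordinate, \<open>\<phi>\<close> satisfies the Cauchy-Riemann equations. As
  \<open>\<psi>\<close> is not assumed continuous, holomorphy comes from Looman-Menchoff.\<close>

lemma dir_deriv_factors_through_coord:
  assumes "\<zeta> \<in> E" "\<rho> > 0" and u: "u \<in> {1..m}"
    and \<phi>: "continuous_on (nbhd \<zeta> \<rho>) \<phi>"
    and deriv: "\<And>z h. \<lbrakk>z \<in> nbhd \<zeta> \<rho>; h \<in> E\<rbrakk> \<Longrightarrow> has_dir_deriv \<phi> h z (h u * \<psi> z)"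
  obtains \<rho>' F where "0 < \<rho>'" "\<rho>' \<le> \<rho>" "F holomorphic_on ball (\<zeta> u) \<rho>'"
    "\<And>z. z \<in> nbhd \<zeta> \<rho>' \<Longrightarrow> \<phi> z = F (z u)"
proof -
  have two: "((\<lambda>\<epsilon>. (\<phi> (vadd_rscale z \<epsilon> h) - \<phi> z) / of_real \<epsilon>) \<longlongrightarrow> h u * \<psi> z) (at 0)"
    if "z \<in> nbhd \<zeta> \<rho>" "h \<in> E" for z h
    using deriv[OF that] deriv[OF that(1) E_uminus[OF that(2)]]
    by (intro has_dir_deriv_two_sided) auto
  \<comment> \<open>Surjectivity of \<open>f\<^sub>u\<close> on \<open>E\<close> supplies directions
    over the real and the imaginary axis.\<close>
  obtain h1 h2 where h: "h1 \<in> E" "h1 u = 1" "h2 \<in> E" "h2 u = \<i>"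
    using E_surj[OF u] by (metis UNIV_I imageE)
  \<comment> \<open>\<open>C\<close> bounds how much the section stretches any coordinate; the
    summand 1 makes it positive. Dividing the radius by \<open>C\<close> keeps the section in the
    original polydisc.\<close>
  define C where "C = 1 + (\<Sum>p=1..n. norm (h1 p) + norm (h2 p))"
  have C: "C > 0" "\<And>p. p \<in> {1..n} \<Longrightarrow> norm (h1 p) + norm (h2 p) \<le> C"
  proof -
    show "C > 0" unfolding C_def by (intro add_pos_nonneg sum_nonneg) auto
    show "norm (h1 p) + norm (h2 p) \<le> C" if "p \<in> {1..n}" for p
      using member_le_sum[OF that, of "\<lambda>p. norm (h1 p) + norm (h2 p)"] by (simp add: C_def)
  qed
  define \<rho>' where "\<rho>' = min \<rho> (\<rho> / C)"
  have \<rho>': "0 < \<rho>'" "\<rho>' \<le> \<rho>" using C(1) assms(2) by (auto simp: \<rho>'_def)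
  \<comment> \<open>An affine section through \<open>\<zeta>\<close>: its coordinate
    \<open>u\<close> at \<open>w\<close> is \<open>w\<close>.\<close>
  define s where "s = (\<lambda>w. vadd_rscale (vadd_rscale \<zeta> (Re (w - \<zeta> u)) h1) (Im (w - \<zeta> u)) h2)"
  have s_u: "s w u = w" for w
    using h by (simp add: s_def vadd_rscale_def complex_eq_iff)
  have s_in: "s w \<in> nbhd \<zeta> \<rho>" if "w \<in> ball (\<zeta> u) \<rho>'" for w
  proof -
    have "norm (s w p - \<zeta> p) < \<rho>" if p: "p \<in> {1..n}" for p
    proof -
      have "norm (s w p - \<zeta> p) \<le> \<bar>Re (w - \<zeta> u)\<bar> * norm (h1 p) + \<bar>Im (w - \<zeta> u)\<bar> * norm (h2 p)"
        unfolding s_def vadd_rscale_def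
        using norm_triangle_ineq[of "of_real (Re (w - \<zeta> u)) * h1 p" "of_real (Im (w - \<zeta> u)) * h2 p"]
        by (simp add: norm_mult del: minus_complex.sel of_real_diff)
      also have "\<dots> \<le> norm (w - \<zeta> u) * norm (h1 p) + norm (w - \<zeta> u) * norm (h2 p)"
        by (intro add_mono mult_right_mono abs_Re_le_cmod abs_Im_le_cmod) auto
      also have "\<dots> \<le> norm (w - \<zeta> u) * C"
        using C(2)[OF p] by (simp add: mult_left_mono flip: distrib_left)
      also have "\<dots> < \<rho> / C * C"
        using \<open>w \<in> ball (\<zeta> u) \<rho>'\<close> C(1)
        by (intro mult_strict_right_mono) (auto simp: \<rho>'_def dist_norm norm_minus_commute)
      finally show ?thesis using C(1) by simp
    qed
    then show ?thesis using h assms(1) E_lin by (simp add: nbhd_def s_def)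
  qed
  have s_cont: "continuous_on A s" for A
    unfolding s_def vadd_rscale_def
    by (intro continuous_on_coordinatewise_then_product continuous_intros)
  define F where "F = (\<lambda>w. \<phi> (s w))"
  have "F holomorphic_on ball (\<zeta> u) \<rho>'"
  proof (rule Looman_Menchoff)
    show "continuous_on (ball (\<zeta> u) \<rho>') F"
      unfolding F_def by (rule continuous_on_compose2[OF \<phi> s_cont]) (use s_in in auto)
    fix w assume w: "w \<in> ball (\<zeta> u) \<rho>'"
    have "s (w + of_real t) = vadd_rscale (s w) t h1"
      "s (w + \<i> * of_real t) = vadd_rscale (s w) t h2" for t
      by (simp_all add: s_def vadd_rscale_def fun_eq_iff algebra_simps)
    moreover have "((\<lambda>t. (\<phi> (vadd_rscale (s w) t h1) - \<phi> (s w)) / of_real t) \<longlongrightarrow> \<psi> (s w)) (at 0)"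
      using two[OF s_in[OF w] h(1)] h(2) by simp
    moreover have "((\<lambda>t. (\<phi> (vadd_rscale (s w) t h2) - \<phi> (s w)) / (\<i> * of_real t))
        \<longlongrightarrow> \<psi> (s w)) (at 0)"
    proof -
      \<comment> \<open>In direction \<open>h2\<close> the derivative is
        \<open>\<i> * \<psi>\<close>, and the axis quotient divides by the extra
        \<open>\<i>\<close>.\<close>
      have "((\<lambda>t. (\<phi> (vadd_rscale (s w) t h2) - \<phi> (s w)) / of_real t / \<i>)
          \<longlongrightarrow> \<i> * \<psi> (s w) / \<i>) (at 0)"
        using two[OF s_in[OF w] h(3)] h(4) by (intro tendsto_divide) auto
      moreover have "x / of_real t / \<i> = x / (\<i> * of_real t)" for x and t :: real
        by (simp only: divide_divide_eq_left mult.commute)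
      ultimately show ?thesis by (simp only: nonzero_mult_div_cancel_left[OF complex_i_not_zero])
    qed
    ultimately have "has_axis_deriv F w (\<psi> (s w))"
      by (simp add: has_axis_deriv_def F_def)
    then show "\<exists>s. has_axis_deriv F w s" by blast
  qed simp
  moreover have "\<phi> z = F (z u)" if z: "z \<in> nbhd \<zeta> \<rho>'" for z
  proof -
    have zu: "z u \<in> ball (\<zeta> u) \<rho>'"
      using z u mn by (auto simp: nbhd_def dist_norm norm_minus_commute)
    define y where "y = s (z u)"
    have y: "y \<in> nbhd \<zeta> \<rho>" using s_in[OF zu] by (simp add: y_def)
    have z\<rho>: "z \<in> nbhd \<zeta> \<rho>" using z nbhd_mono[OF \<rho>'(2)] by blast
    define h where "h = (\<lambda>p. z p - y p)"
    have hE: "h \<in> E" unfolding h_def using y z\<rho> nbhd_sub_E by (intro E_diff) auto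
    have hu: "h u = 0" by (simp add: h_def y_def s_u)
    have y1: "vadd_rscale y 1 h = z" by (simp add: vadd_rscale_def h_def)
    \<comment> \<open>The segment from \<open>y\<close> to \<open>z\<close> stays in the polydisc by
      convexity, and along it the derivative is \<open>h u * \<psi>\<close>, which is 0.\<close>
    have "\<exists>c. \<forall>t\<in>{0..1}. \<phi> (vadd_rscale y t h) = c"
    proof (rule has_derivative_zero_constant)
      fix t :: real assume t: "t \<in> {0..1}"
      have yt: "vadd_rscale y t h \<in> nbhd \<zeta> \<rho>"
        by (rule nbhd_convex[OF y _ hE]) (use t z\<rho> in \<open>auto simp: y1\<close>)
      have "((\<lambda>\<epsilon>. (\<phi> (vadd_rscale y (t + \<epsilon>) h) - \<phi> (vadd_rscale y (t + 0) h)) / of_real \<epsilon>) \<longlongrightarrow> 0) (at 0)"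
        using two[OF yt hE] hu by (simp add: vadd_rscale_vadd_rscale)
      then have "((\<lambda>\<epsilon>. \<phi> (vadd_rscale y (t + \<epsilon>) h)) has_vector_derivative 0) (at 0)"
        by (rule iffD1[OF quotient_tendsto_iff_has_vector_derivative])
      moreover have "((\<lambda>x. x - t) has_vector_derivative 1) (at t)"
        by (auto intro!: derivative_eq_intros)
      ultimately have "((\<lambda>\<epsilon>. \<phi> (vadd_rscale y \<epsilon> h)) has_vector_derivative 0) (at t)"
        using vector_diff_chain_at[of "\<lambda>x. x - t" 1 t "\<lambda>\<epsilon>. \<phi> (vadd_rscale y (t + \<epsilon>) h)" 0]
        by (simp add: o_def)
      then show "((\<lambda>t. \<phi> (vadd_rscale y t h)) has_derivative (\<lambda>h. 0)) (at t within {0..1})"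
        by (simp add: has_vector_derivative_def has_derivative_at_withinI)
    qed simp
    then have "\<phi> (vadd_rscale y 1 h) = \<phi> (vadd_rscale y 0 h)" by force
    then show ?thesis by (simp add: y1 F_def) (simp add: y_def)
  qed
  ultimately show ?thesis using that \<rho>' by blast
qed

text \<open>Induction on the number \<open>d\<close> of coordinates that may still be nonzero. The
  leading coordinate is a holomorphic function of one scalar; subtracting its Taylor extension
  clears it, and the derivative of that extension is again a Taylor extension. The neighbourhood may
  shrink at each step.\<close>

lemma local_second_derivative:
  assumes "\<zeta> \<in> E" "\<rho> > 0" "1 \<le> r" "r + d = n + 1"
    and "continuous_on (nbhd \<zeta> \<rho>) \<Phi>" "gateaux (nbhd \<zeta> \<rho>) \<Phi> D"
    and "\<And>z p. \<lbrakk>z \<in> nbhd \<zeta> \<rho>; p < r \<or> n < p\<rbrakk> \<Longrightarrow> \<Phi> z p = 0"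
  shows "\<exists>\<rho>' D2. 0 < \<rho>' \<and> \<rho>' \<le> \<rho> \<and> continuous_on (nbhd \<zeta> \<rho>') D \<and> gateaux (nbhd \<zeta> \<rho>') D D2"
  using assms
proof (induction d arbitrary: r \<rho> \<Phi> D)
  case 0
  \<comment> \<open>Here \<open>r = n + 1\<close>, so every coordinate of \<open>\<Phi>\<close>
    vanishes, and with it the derivative in the direction of the unit.\<close>
  have D0: "D z = (\<lambda>_. 0)" if "z \<in> nbhd \<zeta> \<rho>" for z
    using gateaux_below_0[OF 0(6) 0(7) that] 0(4) by (intro ext) force
  have "has_dir_deriv (\<lambda>z. D z p) h z 0" if "z \<in> nbhd \<zeta> \<rho>" "h \<in> E" for z h p
    using has_dir_deriv_const[of 0 h z]
    by (rule has_dir_deriv_transform)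
       (use D0 that eventually_mono[OF eventually_in_nbhd[OF that]] in auto)
  then have "gateaux (nbhd \<zeta> \<rho>) D (\<lambda>_ _. 0)"
    by (auto simp: gateaux_deriv_on_iff carrierA_def amult_def)
  moreover have "continuous_on (nbhd \<zeta> \<rho>) D"
    using continuous_on_const[of "nbhd \<zeta> \<rho>" "\<lambda>_. 0"] D0 by (simp cong: continuous_on_cong)
  ultimately show ?case using 0(2) by blast
next
  case (Suc d)
  let ?u = "idem_index r"
  have r: "r \<in> {1..n}" using Suc.prems(3,4) by auto
  have u: "?u \<in> {1..m}" "?u \<in> {1..n}" using idem_index[OF r] mn by auto
  have D0: "D z p = 0" if "z \<in> nbhd \<zeta> \<rho>" "p < r" for z p
    using gateaux_below_0[OF Suc.prems(6)] Suc.prems(7) that by blast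
  have deriv_r: "has_dir_deriv (\<lambda>z. \<Phi> z r) h z (h ?u * D z r)"
    if "z \<in> nbhd \<zeta> \<rho>" "h \<in> E" for z h
  proof -
    have "has_dir_deriv (\<lambda>z. \<Phi> z r) h z (mul h (D z) r)"
      using Suc.prems(6) that unfolding gateaux_deriv_on_iff by blast
    \<comment> \<open>The coordinates of \<open>D\<close> below \<open>r\<close> vanish because
      those of \<open>\<Phi>\<close> do; this makes \<open>r\<close> the leading index and the
      derivative a scalar multiple of \<open>h ?u\<close>.\<close>
    moreover have "mul h (D z) r = h ?u * D z r"
      by (rule mul_leading[OF _ r]) (rule D0[OF that(1)])
    ultimately show ?thesis by simp
  qed
  obtain \<rho>1 F where F: "0 < \<rho>1" "\<rho>1 \<le> \<rho>" "F holomorphic_on ball (\<zeta> ?u) \<rho>1"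
    "\<And>z. z \<in> nbhd \<zeta> \<rho>1 \<Longrightarrow> \<Phi> z r = F (z ?u)"
    by (rule dir_deriv_factors_through_coord[OF Suc.prems(1,2) u(1)
      continuous_on_product_then_coordinatewise[OF Suc.prems(5), of r]]) (rule deriv_r, assumption+, rule that)
  have ball: "z ?u \<in> ball (\<zeta> ?u) \<rho>1" if "z \<in> nbhd \<zeta> \<rho>1" for z
    using that u(2) by (auto simp: nbhd_def dist_norm norm_minus_commute)
  have sub: "nbhd \<zeta> \<rho>1 \<subseteq> nbhd \<zeta> \<rho>" using F(2) by (rule nbhd_mono)
  have F': "deriv F holomorphic_on ball (\<zeta> ?u) \<rho>1" using F(3) by (rule holomorphic_deriv) simp
  have ext: "gateaux (nbhd \<zeta> \<rho>1) (hol_ext r F) (hol_ext r (deriv F))"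
    "gateaux (nbhd \<zeta> \<rho>1) (hol_ext r (deriv F)) (hol_ext r (deriv (deriv F)))"
    using ball nbhd_sub_E by (intro gateaux_hol_ext[OF r F(3)] gateaux_hol_ext[OF r F']; simp)+
  have cext: "continuous_on (nbhd \<zeta> \<rho>1) (hol_ext r F)"
    "continuous_on (nbhd \<zeta> \<rho>1) (hol_ext r (deriv F))"
    using ball by (intro continuous_on_hol_ext[OF F(3)] continuous_on_hol_ext[OF F']; simp)+
  define \<Phi>' where "\<Phi>' = (\<lambda>z p. \<Phi> z p - hol_ext r F z p)"
  define D' where "D' = (\<lambda>z p. D z p - hol_ext r (deriv F) z p)"
  have "\<exists>\<rho>' D2. 0 < \<rho>' \<and> \<rho>' \<le> \<rho>1 \<and> continuous_on (nbhd \<zeta> \<rho>') D' \<and> gateaux (nbhd \<zeta> \<rho>') D' D2"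
  proof (rule Suc.IH[of \<rho>1 "Suc r" \<Phi>'])
    show "gateaux (nbhd \<zeta> \<rho>1) \<Phi>' D'"
      unfolding \<Phi>'_def D'_def by (intro gateaux_diff gateaux_subset[OF Suc.prems(6) sub] ext)
    show "continuous_on (nbhd \<zeta> \<rho>1) \<Phi>'"
      unfolding \<Phi>'_def
      by (intro continuous_on_coordinatewise_then_product continuous_on_diff
          continuous_on_product_then_coordinatewise[OF continuous_on_subset[OF Suc.prems(5) sub]]
          continuous_on_product_then_coordinatewise[OF cext(1)])
    show "\<Phi>' z p = 0" if "z \<in> nbhd \<zeta> \<rho>1" and p: "p < Suc r \<or> n < p" for z p
    proof -
      have zc: "z \<in> carrierA n" using that(1) nbhd_sub_E E_sub by blast
      consider "p < r" | "p = r" | "n < p" using p by linarith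
      then show ?thesis
      proof cases
        case 1
        then show ?thesis using that(1) sub Suc.prems(7) hol_ext_below[OF r zc] by (auto simp: \<Phi>'_def)
      next
        case 2
        then show ?thesis using F(4)[OF that(1)] hol_ext_leading[OF r zc] by (simp add: \<Phi>'_def)
      next
        case 3
        then show ?thesis
          using that(1) sub Suc.prems(7) carrierA_0[OF hol_ext_carrier[OF r], of p] by (auto simp: \<Phi>'_def)
      qed
    qed
  qed (use Suc.prems F in auto)
  then obtain \<rho>' D2 where *: "0 < \<rho>'" "\<rho>' \<le> \<rho>1" "continuous_on (nbhd \<zeta> \<rho>') D'"
    "gateaux (nbhd \<zeta> \<rho>') D' D2" by blast
  have sub': "nbhd \<zeta> \<rho>' \<subseteq> nbhd \<zeta> \<rho>1" using *(2) by (rule nbhd_mono)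
  \<comment> \<open>\<open>D\<close> is recovered from \<open>D'\<close>, treated by the induction
    hypothesis, and the extension of \<open>deriv F\<close>, whose derivative is the extension of
    the second derivative of \<open>F\<close>.\<close>
  have D: "D = (\<lambda>z p. D' z p + hol_ext r (deriv F) z p)" by (simp add: D'_def fun_eq_iff)
  have "continuous_on (nbhd \<zeta> \<rho>') D"
    unfolding D
    by (intro continuous_on_coordinatewise_then_product continuous_on_add
        continuous_on_product_then_coordinatewise[OF *(3)]
        continuous_on_product_then_coordinatewise[OF continuous_on_subset[OF cext(2) sub']])
  moreover have "gateaux (nbhd \<zeta> \<rho>') D (\<lambda>z p. D2 z p + hol_ext r (deriv (deriv F)) z p)"
    using gateaux_add[OF *(4) gateaux_subset[OF ext(2) sub']] by (simp add: D'_def)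
  ultimately show ?case using * F(2) by (intro exI[of _ \<rho>']) auto
qed

text \<open>Continuity and Gateaux differentiability at a point are local, so the local results at
  the individual points can be assembled.\<close>

lemma gateaux_derivative_monogenic:
  assumes \<Omega>: "openin (top_of_set E) \<Omega>"
    and mono: "monogenic n m Ups uu E \<Omega> \<Phi>" and D: "gateaux \<Omega> \<Phi> D"
  shows "monogenic n m Ups uu E \<Omega> D"
proof -
  have \<Omega>E: "\<Omega> \<subseteq> E" using openin_imp_subset[OF \<Omega>] .
  have local: "\<exists>\<rho> D2. 0 < \<rho> \<and> nbhd \<zeta> \<rho> \<subseteq> \<Omega> \<and> continuous_on (nbhd \<zeta> \<rho>) D \<and> gateaux (nbhd \<zeta> \<rho>) D D2"
    if \<zeta>: "\<zeta> \<in> \<Omega>" for \<zeta>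
  proof -
    obtain \<rho> where \<rho>: "\<rho> > 0" "nbhd \<zeta> \<rho> \<subseteq> \<Omega>" using openin_contains_nbhd[OF \<Omega> \<zeta>] by blast
    \<comment> \<open>The induction starts with \<open>r = 1\<close> and \<open>d = n\<close>:
      coordinate 0 and those above \<open>n\<close> vanish on the carrier.\<close>
    have "\<Phi> z p = 0" if "z \<in> nbhd \<zeta> \<rho>" "p < 1 \<or> n < p" for z p
    proof -
      have "\<Phi> z \<in> carrierA n" using mono that(1) \<rho>(2) by (auto simp: monogenic_def)
      then show ?thesis using carrierA_0[of "\<Phi> z" p] that(2) by auto
    qed
    then have "\<exists>\<rho>' D2. 0 < \<rho>' \<and> \<rho>' \<le> \<rho> \<and> continuous_on (nbhd \<zeta> \<rho>') D \<and> gateaux (nbhd \<zeta> \<rho>') D D2"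
      using \<zeta> \<Omega>E \<rho> mono continuous_on_subset gateaux_subset[OF D \<rho>(2)]
      by (intro local_second_derivative[where r = 1 and d = n and \<Phi> = \<Phi>]) (auto simp: monogenic_def)
    then show ?thesis using \<rho>(2) nbhd_mono by (meson order_trans)
  qed
  then obtain \<rho> D2 where \<rho>: "\<And>\<zeta>. \<zeta> \<in> \<Omega> \<Longrightarrow> 0 < \<rho> \<zeta>" "\<And>\<zeta>. \<zeta> \<in> \<Omega> \<Longrightarrow> nbhd \<zeta> (\<rho> \<zeta>) \<subseteq> \<Omega>"
    "\<And>\<zeta>. \<zeta> \<in> \<Omega> \<Longrightarrow> continuous_on (nbhd \<zeta> (\<rho> \<zeta>)) D"
    "\<And>\<zeta>. \<zeta> \<in> \<Omega> \<Longrightarrow> gateaux (nbhd \<zeta> (\<rho> \<zeta>)) D (D2 \<zeta>)" by metis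
  have center: "\<zeta> \<in> nbhd \<zeta> (\<rho> \<zeta>)" if "\<zeta> \<in> \<Omega>" for \<zeta>
    using that \<Omega>E \<rho>(1) nbhd_center by blast
  \<comment> \<open>The derivative at a point is taken from the neighbourhood centred there; the
    local choices need not be compared with each other.\<close>
  have "gateaux \<Omega> D (\<lambda>\<zeta>. D2 \<zeta> \<zeta>)"
    using \<rho>(4) center unfolding gateaux_deriv_on_iff by blast
  moreover have "continuous_on \<Omega> D"
    unfolding continuous_on_eq_continuous_within
  proof
    fix \<zeta> assume \<zeta>: "\<zeta> \<in> \<Omega>"
    obtain O' where O': "open O'" "nbhd \<zeta> (\<rho> \<zeta>) = E \<inter> O'" using nbhd_open by blast
    have "at \<zeta> within \<Omega> = at \<zeta> within nbhd \<zeta> (\<rho> \<zeta>)"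
    proof (rule at_within_nhd[OF _ O'(1)])
      show "\<zeta> \<in> O'" using center[OF \<zeta>] O'(2) by blast
      show "\<Omega> \<inter> O' - {\<zeta>} = nbhd \<zeta> (\<rho> \<zeta>) \<inter> O' - {\<zeta>}"
        using O'(2) \<rho>(2)[OF \<zeta>] \<Omega>E by blast
    qed
    then show "continuous (at \<zeta> within \<Omega>) D"
      using \<rho>(3)[OF \<zeta>] center[OF \<zeta>] by (simp add: continuous_on_eq_continuous_within)
  qed
  moreover have "D ` \<Omega> \<subseteq> carrierA n" using D by (auto simp: gateaux_deriv_on_iff)
  ultimately show ?thesis unfolding monogenic_def by blast
qed

end

section \<open>Gateaux derivatives of all orders\<close>

theorem theorem3:
  fixes n m k :: nat
    and Ups :: "nat \<Rightarrow> nat \<Rightarrow> nat \<Rightarrow> complex"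
    and uu :: "nat \<Rightarrow> nat"
    and e :: "nat \<Rightarrow> (nat \<Rightarrow> complex)"
    and \<Omega> :: "(nat \<Rightarrow> complex) set"
    and \<Phi> :: "(nat \<Rightarrow> complex) \<Rightarrow> (nat \<Rightarrow> complex)"
  assumes mn: "1 \<le> m" "m \<le> n"
    and uu: "\<forall>s\<in>{m+1..n}. uu s \<in> {1..m}"
    and comm: "\<forall>a\<in>carrierA n. \<forall>b\<in>carrierA n. amult n m Ups uu a b = amult n m Ups uu b a"
    and assoc: "\<forall>a\<in>carrierA n. \<forall>b\<in>carrierA n. \<forall>c\<in>carrierA n.
        amult n m Ups uu (amult n m Ups uu a b) c = amult n m Ups uu a (amult n m Ups uu b c)"
    and k: "2 \<le> k" "k \<le> 2 * n"
    and e1: "e 1 = aunit m"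
    and eA: "\<forall>j\<in>{2..k}. e j \<in> carrierA n"
    and indep: "\<forall>c :: nat \<Rightarrow> real.
        (\<forall>p. (\<Sum>j=1..k. complex_of_real (c j) * e j p) = 0) \<longrightarrow> (\<forall>j\<in>{1..k}. c j = 0)"
    and fu: "\<forall>u\<in>{1..m}. (\<lambda>x. x u) ` Espan k e = UNIV"
    and dom_sub: "\<Omega> \<subseteq> Espan k e"
    and dom_open: "openin (top_of_set (Espan k e)) \<Omega>"
    and dom_conn: "connected \<Omega>" and dom_ne: "\<Omega> \<noteq> {}"
    and mono: "monogenic n m Ups uu (Espan k e) \<Omega> \<Phi>"
  shows "\<forall>r::nat. \<exists>\<Psi> :: nat \<Rightarrow> (nat \<Rightarrow> complex) \<Rightarrow> (nat \<Rightarrow> complex).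
           (\<forall>\<zeta>\<in>\<Omega>. \<Psi> 0 \<zeta> = \<Phi> \<zeta>) \<and>
           (\<forall>j<r. gateaux_deriv_on n m Ups uu (Espan k e) \<Omega> (\<Psi> j) (\<Psi> (Suc j))) \<and>
           monogenic n m Ups uu (Espan k e) \<Omega> (\<Psi> r)"
proof -
  have "e j \<in> carrierA n" if "j \<in> {1..k}" for j
  proof (cases "j = 1")
    case True
    then show ?thesis using e1 mn by (auto simp: carrierA_def aunit_def)
  next
    case False
    then show ?thesis using eA that by auto
  qed
  then have E_sub: "Espan k e \<subseteq> carrierA n"
    by (auto simp: Espan_def carrierA_def)
  interpret monogenic_setting n m Ups uu "Espan k e"
  proof
    \<comment> \<open>The coefficients of the new vector are \<open>c j + t * d j\<close>.\<close>
    show "vadd_rscale z t h \<in> Espan k e" if "z \<in> Espan k e" "h \<in> Espan k e" for z h t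
    proof -
      obtain c d where "z = (\<lambda>p. \<Sum>j=1..k. complex_of_real (c j) * e j p)"
        "h = (\<lambda>p. \<Sum>j=1..k. complex_of_real (d j) * e j p)"
        using \<open>z \<in> Espan k e\<close> \<open>h \<in> Espan k e\<close> by (auto simp: Espan_def)
      then show ?thesis
        unfolding Espan_def
        by (auto intro!: exI[of _ "\<lambda>j. c j + t * d j"]
            simp: vadd_rscale_def sum_distrib_left sum.distrib algebra_simps)
    qed
    show "aunit m \<in> Espan k e"
    proof -
      have "(\<Sum>j=1..k. complex_of_real (if j = 1 then 1 else 0) * e j p) = aunit m p" for p
      proof -
        have "(\<Sum>j=1..k. complex_of_real (if j = 1 then 1 else 0) * e j p)
            = (\<Sum>j=1..k. if j = 1 then e 1 p else 0)"
          by (intro sum.cong refl) auto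
        then show ?thesis using k(1) e1 by simp
      qed
      then show ?thesis
        unfolding Espan_def by (auto intro!: exI[of _ "\<lambda>j. if j = 1 then 1 else 0"])
    qed
  qed (use mn uu comm assoc E_sub fu in auto)
  \<comment> \<open>A choice of derivative for each function; any derivative of a monogenic function
    is monogenic by \<open>gateaux_derivative_monogenic\<close>, so the choice can be
    iterated.\<close>
  define next_deriv where
    "next_deriv = (\<lambda>f. SOME D. gateaux_deriv_on n m Ups uu (Espan k e) \<Omega> f D)"
  define \<Psi> where "\<Psi> = (\<lambda>j. (next_deriv ^^ j) \<Phi>)"
  have step: "gateaux_deriv_on n m Ups uu (Espan k e) \<Omega> f (next_deriv f)"
    if "monogenic n m Ups uu (Espan k e) \<Omega> f" for f
  proof -
    have "\<exists>D. gateaux_deriv_on n m Ups uu (Espan k e) \<Omega> f D"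
      using that by (simp add: monogenic_def)
    then show ?thesis unfolding next_deriv_def by (rule someI_ex)
  qed
  have mono_j: "monogenic n m Ups uu (Espan k e) \<Omega> (\<Psi> j)" for j
  proof (induction j)
    case 0
    then show ?case using mono by (simp add: \<Psi>_def)
  next
    case (Suc j)
    have "monogenic n m Ups uu (Espan k e) \<Omega> (next_deriv (\<Psi> j))"
      by (rule gateaux_derivative_monogenic[OF dom_open Suc.IH step[OF Suc.IH]])
    then show ?case by (simp add: \<Psi>_def)
  qed
  have deriv_j: "gateaux_deriv_on n m Ups uu (Espan k e) \<Omega> (\<Psi> j) (\<Psi> (Suc j))" for j
    using step[OF mono_j[of j]] by (simp add: \<Psi>_def)
  show ?thesis
  proof
    fix r
    show "\<exists>\<Psi>. (\<forall>\<zeta>\<in>\<Omega>. \<Psi> 0 \<zeta> = \<Phi> \<zeta>) \<and>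
        (\<forall>j<r. gateaux_deriv_on n m Ups uu (Espan k e) \<Omega> (\<Psi> j) (\<Psi> (Suc j))) \<and>
        monogenic n m Ups uu (Espan k e) \<Omega> (\<Psi> r)"
      using mono_j deriv_j by (intro exI[of _ \<Psi>]) (auto simp: \<Psi>_def)
  qed
qed

end
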